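(* Let $F$ be a field of characteristic zero, $k\ge2$, $n\ge 1$ and $0\le r\le n$. The $(n,r)$th $U$-cocharacter of $M_k(F)$ is $$\chi^U_{(n;r)}(M_k(F))=\begin{cases}\displaystyle\binom nr\,\chi_{(n)}\otimes\chi_{\emptyset} & \text{if } r=n,\\[2mm] \displaystyle\binom nr (k^2-1)^2\,\chi_{(n-1)}\otimes\chi_{(1)} & \text{if } r=n-1,\\[2mm] \displaystyle\binom nr(k^2-1)^{n-r}k^2\,\chi_{(r)}\otimes\chi_{(n-r)} & \text{if } 0\le r\le n-2.\end{cases}$$
   Context: $L=\operatorname{Der}(M_k(F))$, identified with $\mathrm{sl}_k(F)$ via $c\mapsto\operatorname{ad}_c$, $\operatorname{ad}_c(x)=cx-xc$; $\phi:U(L)\to\operatorname{End}_F(M_k(F))$ is the unital algebra homomorphism from the universal enveloping algebra extending this action, and $U:=\phi(U(L))$. $e_{ij}$ are matrix units, $h_i:=e_{ii}-e_{i+1,i+1}$ ($1\le i<k$), $g:=I_k$, $\mathcal S:=\{e_{ij}\mid i\neq j\}\cup\{h_1,\dots,h_{k-1}\}$, $\mathcal M:=\mathcal S\cup\{g\}$ (a basis of $M_k(F)$). For $a,b\in\mathcal M$, $\varphi_{ab}$ is the linear endomorphism of $M_k(F)$ sending $a$ to $b$ and the other elements of $\mathcal M$ to $0$; $\{\varphi_{ab}\}_{a,b\in\mathcal S}\cup\{\varphi_{gg}\}$ is a basis of $U$. $F\langle X|U\rangle$ is the free nonunital associative algebra on the symbols $x_i^{ab}:=x_i^{\varphi_{ab}}$,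 $i\ge1$, with ($a,b\in\mathcal S$ or $a=b=g$). $\operatorname{Id}^U(M_k(F))$ is the set of $f\in F\langle X|U\rangle$ vanishing under all evaluations $x_i\mapsto m_i\in M_k(F)$, $x_i^{ab}\mapsto\varphi_{ab}(m_i)$. For an ordered pair $(\mathcal I,\mathcal J)$ of disjoint (possibly empty) sets with $\mathcal I\cup\mathcal J=\{1,\dots,n\}$ and $\boldsymbol a=(a_j)_{j\in\mathcal J}\in\mathcal S^{|\mathcal J|}$, put $a_i:=g$ for $i\in\mathcal I$ and let $P^U_{\mathcal I,\mathcal J,\boldsymbol a}$ be the span of the monomials $x_{\rho(1)}^{a_{\rho(1)}b_1}\cdots x_{\rho(n)}^{a_{\rho(n)}b_n}$ with $\rho\in S_n$, $b_l=g$ if $\rho(l)\in\mathcal I$ and $b_l\in\mathcal S$ if $\rho(l)\in\mathcal J$. The group $S_{\mathcal I}\times S_{\mathcal J}$ acts on it by permuting variables together with their first exponent index: if $\pi=(\sigma,\tau)$ acts on $\{1,\dots,n\}$ as $\sigma$ on $\mathcal I$ and $\tau$ on $\mathcal J$, then $(\sigma,\tau)\bigl(x_{\rho(1)}^{a_{\rho(1)}b_1}\cdots x_{\rho(n)}^{a_{\rho(n)}b_n}\bigr):=x_{\pi\rho(1)}^{a_{\pi\rho(1)}b_1}\cdots x_{\pi\rho(n)}^{a_{\pi\rho(n)}b_n}$. This action preserves $P^U_{\mathcal I,\mathcal J,\boldsymbol a}\cap\operatorname{Id}^U(M_k(F))$, so the quotient $P^U_{\mathcal I,\mathcal J,\boldsymbol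 a}(M_k(F)):=P^U_{\mathcal I,\mathcal J,\boldsymbol a}/(P^U_{\mathcal I,\mathcal J,\boldsymbol a}\cap\operatorname{Id}^U(M_k(F)))$ is an $S_{\mathcal I}\times S_{\mathcal J}$-module; when $|\mathcal I|=r$ it is regarded as an $S_r\times S_{n-r}$-module through $S_{\mathcal I}\times S_{\mathcal J}\cong S_r\times S_{n-r}$ (induced by bijections $\mathcal I\to\{1,\dots,r\}$, $\mathcal J\to\{r+1,\dots,n\}$). The $(n,r)$th $U$-cocharacter $\chi^U_{(n;r)}(M_k(F))$ is the character of the $S_r\times S_{n-r}$-module $$P^U_{(n;r)}(M_k(F)):=\bigoplus_{(\mathcal I,\mathcal J):\,|\mathcal I|=r,\ \boldsymbol a\in\mathcal S^{n-r}}P^U_{\mathcal I,\mathcal J,\boldsymbol a}(M_k(F)).$$ $\chi_\lambda$ denotes the irreducible character of the symmetric group $S_m$ attached to the partition $\lambda\vdash m$ (so $\chi_{(m)}$ is the trivial character, and $\chi_\emptyset$ is the character of the trivial group $S_0$). *)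

theory Defs
  imports
    "HOL-Library.FuncSet"
    "HOL-Library.Poly_Mapping"
    "HOL-Library.Function_Algebras"
    "HOL-Combinatorics.Permutations"
    "Jordan_Normal_Form.Matrix"
begin

section \<open>Finitely supported functions as a vector space\<close>

definition pm_scale :: "'f::field \<Rightarrow> ('w \<Rightarrow>\<^sub>0 'f) \<Rightarrow> ('w \<Rightarrow>\<^sub>0 'f)" where
  "pm_scale c = Poly_Mapping.map (\<lambda>x. c * x)"

lemma lookup_pm_scale [simp]: "Poly_Mapping.lookup (pm_scale c f) w = c * Poly_Mapping.lookup f w"
  by (simp add: pm_scale_def Poly_Mapping.map.rep_eq when_def in_keys_iff)

interpretation pm: vector_space "pm_scale :: 'f::field \<Rightarrow> ('w \<Rightarrow>\<^sub>0 'f) \<Rightarrow> ('w \<Rightarrow>\<^sub>0 'f)"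
  by unfold_locales (rule poly_mapping_eqI, simp add: lookup_add algebra_simps)+

definition pm_push :: "('w \<Rightarrow> 'v) \<Rightarrow> ('w \<Rightarrow>\<^sub>0 'f::field) \<Rightarrow> ('v \<Rightarrow>\<^sub>0 'f)" where
  "pm_push h f = (\<Sum>w\<in>Poly_Mapping.keys f. Poly_Mapping.single (h w) (Poly_Mapping.lookup f w))"

section \<open>Trace on a quotient space\<close>

text \<open>
  For a subspace \<open>W\<close> of \<open>V\<close>, \<open>is_quot_basis s V W B\<close> means that the classes of the elements
  of \<open>B\<close> are distinct and form a finite basis of \<open>V / W\<close>. If \<open>V / W\<close> is finite-dimensional,
  \<open>quot_trace s V W T\<close> is the trace of the endomorphism of \<open>V / W\<close> induced by a linear
  map \<open>T\<close> that preserves \<open>V\<close> and \<open>W\<close>. It does not depend on the chosen basis.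
\<close>

definition is_quot_coords ::
  "('f::field \<Rightarrow> 'v \<Rightarrow> 'v::ab_group_add) \<Rightarrow> 'v set \<Rightarrow> 'v set \<Rightarrow> 'v \<Rightarrow> ('v \<Rightarrow> 'f) \<Rightarrow> bool" where
  "is_quot_coords s W B v c \<longleftrightarrow>
     (\<forall>b. b \<notin> B \<longrightarrow> c b = 0) \<and> v - (\<Sum>b\<in>B. s (c b) b) \<in> W"

definition is_quot_basis ::
  "('f::field \<Rightarrow> 'v \<Rightarrow> 'v::ab_group_add) \<Rightarrow> 'v set \<Rightarrow> 'v set \<Rightarrow> 'v set \<Rightarrow> bool" where
  "is_quot_basis s V W B \<longleftrightarrow>
     finite B \<and> B \<subseteq> V \<and> (\<forall>v\<in>V. \<exists>!c. is_quot_coords s W B v c)"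

definition quot_trace ::
  "('f::field \<Rightarrow> 'v \<Rightarrow> 'v::ab_group_add) \<Rightarrow> 'v set \<Rightarrow> 'v set \<Rightarrow> ('v \<Rightarrow> 'v) \<Rightarrow> 'f" where
  "quot_trace s V W T =
     (let B = (SOME B. is_quot_basis s V W B)
      in \<Sum>b\<in>B. (THE c. is_quot_coords s W B (T b) c) b)"

section \<open>Irreducible characters of symmetric groups\<close>

text \<open>
  A partition is a weakly decreasing list of positive integers, and \<open>S\<^sub>m\<close> consists of the
  permutations of \<open>{1..m}\<close>. The boxes of the Young diagram are filled with \<open>1, \<dots>, m\<close>
  row by row; \<open>tab_row\<close> and \<open>tab_col\<close> give the position (counted from 0 and from 1,
  respectively) of an entry in this tableau.
\<close>

definition tab_row :: "nat list \<Rightarrow> nat \<Rightarrow> nat" where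
  "tab_row lam x = (LEAST i. x \<le> sum_list (take (Suc i) lam))"

definition tab_col :: "nat list \<Rightarrow> nat \<Rightarrow> nat" where
  "tab_col lam x = x - sum_list (take (tab_row lam x) lam)"

definition row_group :: "nat list \<Rightarrow> (nat \<Rightarrow> nat) set" where
  "row_group lam = {p. p permutes {1..sum_list lam} \<and>
     (\<forall>x\<in>{1..sum_list lam}. tab_row lam (p x) = tab_row lam x)}"

definition col_group :: "nat list \<Rightarrow> (nat \<Rightarrow> nat) set" where
  "col_group lam = {p. p permutes {1..sum_list lam} \<and>
     (\<forall>x\<in>{1..sum_list lam}. tab_col lam (p x) = tab_col lam x)}"

text \<open>
  Elements of the group algebra are finitely supported functions on permutations. The
  irreducible module attached to \<open>lam\<close> is the left ideal generated by the Young symmetrizer.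
\<close>

definition young_symmetrizer :: "nat list \<Rightarrow> ((nat \<Rightarrow> nat) \<Rightarrow>\<^sub>0 'f::field_char_0)" where
  "young_symmetrizer lam =
     (\<Sum>p\<in>row_group lam. \<Sum>q\<in>col_group lam. Poly_Mapping.single (p \<circ> q) (of_int (sign q)))"

definition left_mult :: "(nat \<Rightarrow> nat) \<Rightarrow> ((nat \<Rightarrow> nat) \<Rightarrow>\<^sub>0 'f::field) \<Rightarrow> ((nat \<Rightarrow> nat) \<Rightarrow>\<^sub>0 'f)" where
  "left_mult p = pm_push (\<lambda>q. p \<circ> q)"

definition specht_module :: "nat list \<Rightarrow> ((nat \<Rightarrow> nat) \<Rightarrow>\<^sub>0 'f::field_char_0) set" where
  "specht_module lam =
     pm.span {left_mult p (young_symmetrizer lam) | p. p permutes {1..sum_list lam}}"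

definition irr_char :: "nat list \<Rightarrow> (nat \<Rightarrow> nat) \<Rightarrow> 'f::field_char_0" where
  "irr_char lam p = quot_trace pm_scale (specht_module lam) {0} (left_mult p)"

definition one_row :: "nat \<Rightarrow> nat list" where
  "one_row m = (if m = 0 then [] else [m])"

definition char_tensor ::
  "((nat \<Rightarrow> nat) \<Rightarrow> 'f::field) \<Rightarrow> ((nat \<Rightarrow> nat) \<Rightarrow> 'f) \<Rightarrow> (nat \<Rightarrow> nat) \<times> (nat \<Rightarrow> nat) \<Rightarrow> 'f" where
  "char_tensor \<chi> \<psi> = (\<lambda>(p, q). \<chi> p * \<psi> q)"

section \<open>The basis of the matrix algebra and the endomorphisms \<open>\<phi>\<^sub>a\<^sub>b\<close>\<close>

text \<open>Matrix indices start at 0.\<close>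

definition e_mat :: "nat \<Rightarrow> nat \<Rightarrow> nat \<Rightarrow> 'f::field mat" where
  "e_mat k i j = mat k k (\<lambda>(p, q). if p = i \<and> q = j then 1 else 0)"

definition h_mat :: "nat \<Rightarrow> nat \<Rightarrow> 'f::field mat" where
  "h_mat k i = e_mat k i i - e_mat k (Suc i) (Suc i)"

definition g_mat :: "nat \<Rightarrow> 'f::field mat" where
  "g_mat k = 1\<^sub>m k"

definition basis_S :: "nat \<Rightarrow> 'f::field mat set" where
  "basis_S k = {e_mat k i j | i j. i < k \<and> j < k \<and> i \<noteq> j} \<union> {h_mat k i | i. Suc i < k}"

definition basis_M :: "nat \<Rightarrow> 'f::field mat set" where
  "basis_M k = basis_S k \<union> {g_mat k}"

definition mat_linear :: "nat \<Rightarrow> ('f::field mat \<Rightarrow> 'f mat) \<Rightarrow> bool" where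
  "mat_linear k f \<longleftrightarrow>
     f \<in> carrier_mat k k \<rightarrow>\<^sub>E carrier_mat k k \<and>
     (\<forall>x\<in>carrier_mat k k. \<forall>y\<in>carrier_mat k k. f (x + y) = f x + f y) \<and>
     (\<forall>c. \<forall>x\<in>carrier_mat k k. f (c \<cdot>\<^sub>m x) = c \<cdot>\<^sub>m f x)"

definition phi :: "nat \<Rightarrow> 'f::field mat \<Rightarrow> 'f mat \<Rightarrow> 'f mat \<Rightarrow> 'f mat" where
  "phi k a b = (THE f. mat_linear k f \<and>
     (\<forall>d\<in>basis_M k. f d = (if d = a then b else 0\<^sub>m k k)))"

section \<open>The free algebra and its identities\<close>

text \<open>
  The triple \<open>(i, a, b)\<close> is the symbol \<open>x\<^sub>i\<close> with exponent \<open>\<phi>\<^sub>a\<^sub>b\<close>. The free nonunital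
  associative algebra on these symbols consists of the linear combinations of nonempty words.
  A word is evaluated to the product of the values of its letters, and a linear combination
  of words entrywise.
\<close>

type_synonym 'f letter = "nat \<times> 'f mat \<times> 'f mat"

type_synonym 'f free_elem = "'f letter list \<Rightarrow>\<^sub>0 'f"

definition letters :: "nat \<Rightarrow> 'f::field letter set" where
  "letters k = {(i, a, b). 1 \<le> i \<and>
     (a \<in> basis_S k \<and> b \<in> basis_S k \<or> a = g_mat k \<and> b = g_mat k)}"

definition free_alg :: "nat \<Rightarrow> 'f::field free_elem set" where
  "free_alg k = {f. \<forall>w\<in>Poly_Mapping.keys f. w \<noteq> [] \<and> set w \<subseteq> letters k}"

definition eval_word :: "nat \<Rightarrow> (nat \<Rightarrow> 'f::field mat) \<Rightarrow> 'f letter list \<Rightarrow> 'f mat" where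
  "eval_word k m w = foldr (\<lambda>(i, a, b) A. phi k a b (m i) * A) w (1\<^sub>m k)"

definition eval_free :: "nat \<Rightarrow> (nat \<Rightarrow> 'f::field mat) \<Rightarrow> 'f free_elem \<Rightarrow> 'f mat" where
  "eval_free k m f =
     mat k k (\<lambda>ij. \<Sum>w\<in>Poly_Mapping.keys f. Poly_Mapping.lookup f w * (eval_word k m w $$ ij))"

definition U_identities :: "nat \<Rightarrow> 'f::field free_elem set" where
  "U_identities k = {f \<in> free_alg k.
     \<forall>m. (\<forall>i. m i \<in> carrier_mat k k) \<longrightarrow> eval_free k m f = 0\<^sub>m k k}"

section \<open>The multilinear components and the cocharacter\<close>

type_synonym 'f index = "nat set \<times> nat set \<times> (nat \<Rightarrow> 'f mat)"

definition indices :: "nat \<Rightarrow> nat \<Rightarrow> nat \<Rightarrow> 'f::field index set" where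
  "indices k n r = {(I, J, a). I \<inter> J = {} \<and> I \<union> J = {1..n} \<and> card I = r \<and>
     a \<in> J \<rightarrow>\<^sub>E basis_S k}"

definition first_exp :: "nat \<Rightarrow> 'f::field index \<Rightarrow> nat \<Rightarrow> 'f mat" where
  "first_exp k = (\<lambda>(I, J, a) i. if i \<in> I then g_mat k else a i)"

definition monomial_word ::
  "nat \<Rightarrow> nat \<Rightarrow> 'f::field index \<Rightarrow> (nat \<Rightarrow> nat) \<Rightarrow> (nat \<Rightarrow> 'f mat) \<Rightarrow> 'f letter list" where
  "monomial_word k n \<iota> \<rho> b = map (\<lambda>l. (\<rho> l, first_exp k \<iota> (\<rho> l), b l)) [1..<Suc n]"

definition P_words :: "nat \<Rightarrow> nat \<Rightarrow> 'f::field index \<Rightarrow> 'f letter list set" where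
  "P_words k n = (\<lambda>(I, J, a). {monomial_word k n (I, J, a) \<rho> b | \<rho> b.
     \<rho> permutes {1..n} \<and>
     (\<forall>l\<in>{1..n}. (\<rho> l \<in> I \<longrightarrow> b l = g_mat k) \<and> (\<rho> l \<in> J \<longrightarrow> b l \<in> basis_S k))})"

definition P_space :: "nat \<Rightarrow> nat \<Rightarrow> 'f::field index \<Rightarrow> 'f free_elem set" where
  "P_space k n \<iota> = pm.span {Poly_Mapping.single w 1 | w. w \<in> P_words k n \<iota>}"

text \<open>
  On \<open>P_space k n \<iota>\<close> the permutation \<open>\<pi>\<close> replaces the variable \<open>x\<^sub>i\<close> and its first
  exponent index \<open>a\<^sub>i\<close> by \<open>x\<^sub>j\<close> and \<open>a\<^sub>j\<close>, where \<open>j = \<pi> i\<close>.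
\<close>

definition perm_act ::
  "nat \<Rightarrow> 'f::field index \<Rightarrow> (nat \<Rightarrow> nat) \<Rightarrow> 'f free_elem \<Rightarrow> 'f free_elem" where
  "perm_act k \<iota> \<pi> = pm_push (map (\<lambda>(i, a, b). (\<pi> i, first_exp k \<iota> (\<pi> i), b)))"

text \<open>The permutation of \<open>A\<close> that corresponds to \<open>p\<close> under the bijection \<open>\<theta>\<close> from \<open>A\<close>.\<close>

definition transport :: "nat set \<Rightarrow> (nat \<Rightarrow> nat) \<Rightarrow> (nat \<Rightarrow> nat) \<Rightarrow> nat \<Rightarrow> nat" where
  "transport A \<theta> p x = (if x \<in> A then inv_into A \<theta> (p (\<theta> x)) else x)"

text \<open>
  The direct sum of the quotients \<open>P_space / (P_space \<inter> U_identities)\<close> is the quotient of the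
  direct sum \<open>P_sum\<close> by \<open>Id_sum\<close>. The elements of these finite direct sums are families
  indexed by \<open>indices k n r\<close>, extended by 0. The bijections \<open>\<alpha> I\<close> from \<open>I\<close> onto \<open>{1..r}\<close> and
  \<open>\<beta> J\<close> from \<open>J\<close> onto \<open>{1..n - r}\<close> identify the symmetric groups of \<open>I\<close> and \<open>J\<close> with
  \<open>S\<^sub>r\<close> and \<open>S\<^sub>n\<^sub>-\<^sub>r\<close>.
\<close>

definition fam_scale :: "'f::field \<Rightarrow> ('i \<Rightarrow> ('w \<Rightarrow>\<^sub>0 'f)) \<Rightarrow> 'i \<Rightarrow> ('w \<Rightarrow>\<^sub>0 'f)" where
  "fam_scale c v = (\<lambda>\<iota>. pm_scale c (v \<iota>))"

definition P_sum :: "nat \<Rightarrow> nat \<Rightarrow> nat \<Rightarrow> ('f::field index \<Rightarrow> 'f free_elem) set" where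
  "P_sum k n r = {v. (\<forall>\<iota>\<in>indices k n r. v \<iota> \<in> P_space k n \<iota>) \<and>
     (\<forall>\<iota>. \<iota> \<notin> indices k n r \<longrightarrow> v \<iota> = 0)}"

definition Id_sum :: "nat \<Rightarrow> nat \<Rightarrow> nat \<Rightarrow> ('f::field index \<Rightarrow> 'f free_elem) set" where
  "Id_sum k n r = {v. (\<forall>\<iota>\<in>indices k n r. v \<iota> \<in> P_space k n \<iota> \<inter> U_identities k) \<and>
     (\<forall>\<iota>. \<iota> \<notin> indices k n r \<longrightarrow> v \<iota> = 0)}"

definition sum_act ::
  "nat \<Rightarrow> (nat set \<Rightarrow> nat \<Rightarrow> nat) \<Rightarrow> (nat set \<Rightarrow> nat \<Rightarrow> nat) \<Rightarrow> (nat \<Rightarrow> nat) \<times> (nat \<Rightarrow> nat) \<Rightarrow>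
   ('f::field index \<Rightarrow> 'f free_elem) \<Rightarrow> 'f index \<Rightarrow> 'f free_elem" where
  "sum_act k \<alpha> \<beta> = (\<lambda>(\<sigma>, \<tau>) v (I, J, a).
     perm_act k (I, J, a) (transport I (\<alpha> I) \<sigma> \<circ> transport J (\<beta> J) \<tau>) (v (I, J, a)))"

definition U_cocharacter ::
  "nat \<Rightarrow> nat \<Rightarrow> nat \<Rightarrow> (nat set \<Rightarrow> nat \<Rightarrow> nat) \<Rightarrow> (nat set \<Rightarrow> nat \<Rightarrow> nat) \<Rightarrow>
   (nat \<Rightarrow> nat) \<times> (nat \<Rightarrow> nat) \<Rightarrow> 'f::field" where
  "U_cocharacter k n r \<alpha> \<beta> \<pi> =
     quot_trace fam_scale (P_sum k n r) (Id_sum k n r) (sum_act k \<alpha> \<beta> \<pi>)"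

end

theory Submission
  imports Defs
begin

text \<open>
  Since \<open>\<phi>\<^sub>a\<^sub>b\<close> maps a matrix to \<open>b\<close> times its coordinate at \<open>a\<close>, a monomial of the component with
  first exponents \<open>a\<^sub>1, \<dots>, a\<^sub>n\<close> evaluates at \<open>m\<^sub>1, \<dots>, m\<^sub>n\<close> to the product of the coordinates of \<open>m\<^sub>i\<close>
  at \<open>a\<^sub>i\<close>, times the matrix \<open>b\<^sub>1 \<dots> b\<^sub>n\<close> (\<open>P_words_eval\<close>). The scalar does not depend on the
  monomial and is 1 for \<open>m\<^sub>i = a\<^sub>i\<close>. Hence an element of the component is an identity if and only
  if the corresponding combination of the matrices \<open>b\<^sub>1 \<dots> b\<^sub>n\<close> vanishes (\<open>identity_iff_coords\<close>),
  and the quotient is isomorphic to the span of all \<open>b\<^sub>1 \<dots> b\<^sub>n\<close>.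

  Among the \<open>b\<^sub>l\<close> there are \<open>r\<close> identity matrices and \<open>n - r\<close> arbitrary elements of \<open>\<S>\<close>. The span
  therefore consists of the scalar matrices if \<open>r = n\<close>, of the traceless matrices if \<open>r = n - 1\<close>, and
  of all matrices otherwise (\<open>coord_product_outside\<close>, \<open>products_span\<close>), of dimension 1, \<open>k\<^sup>2 - 1\<close>
  and \<open>k\<^sup>2\<close>, respectively.

  The symmetric groups move the variables and the \<open>a\<^sub>i\<close>, but leave the sequence of the \<open>b\<^sub>l\<close> as it is.
  So they act trivially on the quotient (\<open>word_coord_perm_act\<close>), and the cocharacter is constant,
  equal to the dimension of the direct sum. The number of components is the binomial coefficient
  times \<open>(k\<^sup>2 - 1) ^ (n - r)\<close> (\<open>card_indices\<close>). The irreducible characters on the right belong to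
  partitions with at most one row and have the constant value 1 (\<open>irr_char_one_row\<close>).
\<close>

section \<open>Traces of maps that act trivially on a quotient\<close>

text \<open>
  If functionals \<open>l\<^sub>x\<close> cut \<open>W\<close> out of \<open>V\<close> and vectors \<open>u\<^sub>x\<close> are dual to them, then the \<open>u\<^sub>x\<close> are a
  basis of \<open>V / W\<close>. The basis \<open>B\<close> chosen in \<open>quot_trace\<close> may be another one. Write \<open>C v\<close> for the
  coordinates with respect to \<open>B\<close>. Each \<open>b\<close> is congruent to the sum of the \<open>l\<^sub>x b\<close> times \<open>u\<^sub>x\<close>, so
  \<open>1 = C b b\<close> is the sum over \<open>x\<close> of \<open>l\<^sub>x b\<close> times \<open>C u\<^sub>x b\<close>. Summing over \<open>b\<close> first turns
  this into the sum of all \<open>l\<^sub>x u\<^sub>x = 1\<close>, so the trace with respect to \<open>B\<close> is the number of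
  elements of \<open>A\<close>.
\<close>

lemma quot_trace_trivial_action:
  fixes s :: "'f::field \<Rightarrow> 'v \<Rightarrow> 'v::ab_group_add"
    and l :: "'x \<Rightarrow> 'v \<Rightarrow> 'f"
  assumes vs: "vector_space s" and V: "module.subspace s V" and fin: "finite A"
    and lin: "\<And>x. x \<in> A \<Longrightarrow> Vector_Spaces.linear s (*) (l x)"
    and W: "W = {v \<in> V. \<forall>x\<in>A. l x v = 0}"
    and u: "\<And>x. x \<in> A \<Longrightarrow> u x \<in> V"
    and dual: "\<And>x y. x \<in> A \<Longrightarrow> y \<in> A \<Longrightarrow> l x (u y) = (if x = y then 1 else 0)"
    and T: "\<And>v. v \<in> V \<Longrightarrow> T v - v \<in> W"
  shows "quot_trace s V W T = of_nat (card A)"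
proof -
  interpret vector_space s by (rule vs)
  have l_diff: "l x (v - w) = l x v - l x w" if "x \<in> A" for x v w
    using module_hom.diff[OF Vector_Spaces.linear.axioms(3)[OF lin[OF that]]] .
  have l_comb: "l x (\<Sum>b\<in>B. s (c b) (f b)) = (\<Sum>b\<in>B. c b * l x (f b))" if "x \<in> A"
    for x c B and f :: "'v \<Rightarrow> 'v"
    by (simp add: module_hom.sum[OF Vector_Spaces.linear.axioms(3)[OF lin[OF that]]]
      module_hom.scale[OF Vector_Spaces.linear.axioms(3)[OF lin[OF that]]])
  have comb_V: "(\<Sum>b\<in>B. s (c b) (f b)) \<in> V" if "\<And>b. b \<in> B \<Longrightarrow> f b \<in> V" for B c and f :: "'v \<Rightarrow> 'v"
    using that by (intro subspace_sum[OF V] subspace_scale[OF V])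
  have coords_iff: "is_quot_coords s W B v c \<longleftrightarrow>
      (\<forall>b. b \<notin> B \<longrightarrow> c b = 0) \<and> (\<forall>x\<in>A. l x v = (\<Sum>b\<in>B. c b * l x b))"
    if "B \<subseteq> V" "v \<in> V" for B v c
  proof -
    have "v - (\<Sum>b\<in>B. s (c b) b) \<in> V"
      using that by (intro subspace_diff[OF V] comb_V) auto
    then show ?thesis
      unfolding is_quot_coords_def W by (auto simp: l_diff l_comb)
  qed
  have inj: "inj_on u A"
    by (rule inj_onI) (metis dual zero_neq_one)
  have "is_quot_basis s V W (u ` A)"
    unfolding is_quot_basis_def
  proof (intro conjI ballI)
    show uV: "u ` A \<subseteq> V" using u by auto
    show "finite (u ` A)" using fin by simp
    fix v assume v: "v \<in> V"
    have co: "is_quot_coords s W (u ` A) v c \<longleftrightarrow>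
        (\<forall>b. b \<notin> u ` A \<longrightarrow> c b = 0) \<and> (\<forall>x\<in>A. l x v = c (u x))" for c
      unfolding coords_iff[OF uV v] sum.reindex[OF inj]
      using fin by (simp add: dual if_distrib[of "\<lambda>z. _ * z"] cong: if_cong)
    show "\<exists>!c. is_quot_coords s W (u ` A) v c"
    proof (rule ex1I)
      show "is_quot_coords s W (u ` A) v (\<lambda>b. if b \<in> u ` A then l (inv_into A u b) v else 0)"
        unfolding co by (auto simp: inv_into_f_f[OF inj])
      fix c assume "is_quot_coords s W (u ` A) v c"
      then show "c = (\<lambda>b. if b \<in> u ` A then l (inv_into A u b) v else 0)"
        unfolding co by (intro ext) (auto simp: inv_into_f_f[OF inj])
    qed
  qed
  then have "is_quot_basis s V W (SOME B. is_quot_basis s V W B)" by (rule someI)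
  then obtain B where B: "is_quot_basis s V W B" and B_def: "B = (SOME B. is_quot_basis s V W B)"
    by blast
  define C where "C v = (THE c. is_quot_coords s W B v c)" for v
  have BV: "B \<subseteq> V" and finB: "finite B" using B by (auto simp: is_quot_basis_def)
  have C: "is_quot_coords s W B v (C v)" if "v \<in> V" for v
    using B that unfolding is_quot_basis_def C_def by (metis theI')
  have Cuniq: "C v = c" if "v \<in> V" "is_quot_coords s W B v c" for v c
    using B that C[OF that(1)] unfolding is_quot_basis_def by blast
  have C_u: "(\<Sum>b\<in>B. C (u x) b * l y b) = l y (u x)" if "x \<in> A" "y \<in> A" for x y
    using C[OF u[OF that(1)]] unfolding coords_iff[OF BV u[OF that(1)]] using that by simp
  have TV: "T b \<in> V" if "b \<in> B" for b
  proof -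
    have "b \<in> V" using that BV by auto
    then have "T b - b + b \<in> V"
      using T[of b] unfolding W by (intro subspace_add[OF V]) auto
    then show ?thesis by simp
  qed
  have l_T: "l x (T b) = l x b" if "x \<in> A" "b \<in> B" for x b
    using T[of b] that BV l_diff[OF that(1), of "T b" b] unfolding W by auto
  \<comment> \<open>The coordinate of \<open>T b\<close> at \<open>b\<close> is computed twice: from \<open>T b\<close> being congruent to \<open>b\<close>,
    and from the expansion of \<open>b\<close> in the \<open>u\<^sub>x\<close>.\<close>
  have C_T: "C (T b) b = 1" if b: "b \<in> B" for b
  proof -
    have "C (T b) = (\<lambda>b'. if b' = b then 1 else 0)"
      using b finB by (intro Cuniq TV)
        (auto simp: coords_iff[OF BV TV[OF b]] l_T if_distrib[of "\<lambda>z. z * _"] cong: if_cong)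
    then show ?thesis by simp
  qed
  have C_T': "C (T b) b = (\<Sum>x\<in>A. l x b * C (u x) b)" if b: "b \<in> B" for b
  proof -
    have "C (T b) = (\<lambda>b'. \<Sum>x\<in>A. l x b * C (u x) b')"
    proof (intro Cuniq TV b)
      have 1: "(\<Sum>b'\<in>B. (\<Sum>x\<in>A. l x b * C (u x) b') * l y b') = l y b" if y: "y \<in> A" for y
      proof -
        have "(\<Sum>b'\<in>B. (\<Sum>x\<in>A. l x b * C (u x) b') * l y b')
            = (\<Sum>x\<in>A. l x b * (\<Sum>b'\<in>B. C (u x) b' * l y b'))"
          unfolding sum_distrib_left sum_distrib_right mult.assoc by (rule sum.swap)
        also have "\<dots> = (\<Sum>x\<in>A. l x b * (if y = x then 1 else 0))"
          using y by (intro sum.cong) (auto simp: C_u dual)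
        also have "\<dots> = l y b" using y fin by (simp add: if_distrib[of "\<lambda>z. _ * z"] cong: if_cong)
        finally show ?thesis .
      qed
      have "C (u x) b' = 0" if "b' \<notin> B" "x \<in> A" for b' x
        using C[OF u[OF that(2)]] that(1) unfolding is_quot_coords_def by blast
      then show "is_quot_coords s W B (T b) (\<lambda>b'. \<Sum>x\<in>A. l x b * C (u x) b')"
        unfolding coords_iff[OF BV TV[OF b]] using 1 b by (auto simp: l_T)
    qed
    then show ?thesis by simp
  qed
  have "quot_trace s V W T = (\<Sum>b\<in>B. C (T b) b)"
    unfolding quot_trace_def Let_def B_def[symmetric] C_def ..
  also have "\<dots> = (\<Sum>b\<in>B. \<Sum>x\<in>A. C (u x) b * l x b)"
    by (intro sum.cong) (auto simp: C_T' mult.commute)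
  also have "\<dots> = (\<Sum>x\<in>A. \<Sum>b\<in>B. C (u x) b * l x b)" by (rule sum.swap)
  also have "\<dots> = of_nat (card A)" by (simp add: C_u dual)
  finally show ?thesis .
qed

section \<open>Linear functionals on finitely supported functions\<close>

definition pm_eval :: "('w \<Rightarrow> 'f::field) \<Rightarrow> ('w \<Rightarrow>\<^sub>0 'f) \<Rightarrow> 'f" where
  "pm_eval g f = (\<Sum>w\<in>Poly_Mapping.keys f. Poly_Mapping.lookup f w * g w)"

lemma pm_eval_superset:
  assumes "finite S" "Poly_Mapping.keys f \<subseteq> S"
  shows "pm_eval g f = (\<Sum>w\<in>S. Poly_Mapping.lookup f w * g w)"
  unfolding pm_eval_def using assms by (intro sum.mono_neutral_left) (auto simp: in_keys_iff)

lemma pm_eval_add: "pm_eval g (f + f') = pm_eval g f + pm_eval g f'"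
proof -
  let ?S = "Poly_Mapping.keys f \<union> Poly_Mapping.keys f'"
  have "Poly_Mapping.keys (f + f') \<subseteq> ?S" by (rule Poly_Mapping.keys_add)
  then show ?thesis
    by (simp add: pm_eval_superset[of ?S] lookup_add algebra_simps sum.distrib)
qed

lemma pm_eval_scale: "pm_eval g (pm_scale c f) = c * pm_eval g f"
proof -
  have "Poly_Mapping.keys (pm_scale c f) \<subseteq> Poly_Mapping.keys f" by (auto simp: in_keys_iff)
  then show ?thesis
    by (simp add: pm_eval_superset[of "Poly_Mapping.keys f"] sum_distrib_left mult.assoc)
qed

lemma pm_eval_zero [simp]: "pm_eval g 0 = 0"
  by (simp add: pm_eval_def)

lemma pm_eval_single: "pm_eval g (Poly_Mapping.single w c) = c * g w"
  by (simp add: pm_eval_superset[of "{w}"])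

lemma pm_eval_sum: "pm_eval g (\<Sum>x\<in>X. f x) = (\<Sum>x\<in>X. pm_eval g (f x))"
  by (induction X rule: infinite_finite_induct) (auto simp: pm_eval_add)

lemma pm_eval_push: "pm_eval g (pm_push h f) = pm_eval (g \<circ> h) f"
  unfolding pm_push_def pm_eval_sum pm_eval_single by (simp add: pm_eval_def)

lemma vector_space_field: "vector_space ((*) :: 'f::field \<Rightarrow> 'f \<Rightarrow> 'f)"
  by unfold_locales (simp_all add: algebra_simps)

lemma linear_lookup: "Vector_Spaces.linear pm_scale (*) (\<lambda>f. Poly_Mapping.lookup f w)"
  by (intro Vector_Spaces.linear_iff[THEN iffD2] conjI allI pm.vector_space_axioms vector_space_field)
     (auto simp: lookup_add)

section \<open>The trivial characters\<close>

text \<open>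
  For a single row the row group is everything and the column group is trivial, so the Young
  symmetrizer is the sum of all permutations. It is fixed by left multiplication and spans a line.
\<close>

lemma irr_char_one_row:
  assumes p: "p permutes {1..m}"
  shows "(irr_char (one_row m) p :: 'f::field_char_0) = 1"
proof -
  have sum: "sum_list (one_row m) = m" by (simp add: one_row_def)
  have row: "tab_row (one_row m) x = 0" if "x \<in> {1..m}" for x
    using that unfolding tab_row_def one_row_def by (intro Least_equality) auto
  have rows: "row_group (one_row m) = {q. q permutes {1..m}}"
  proof -
    have "tab_row (one_row m) (q x) = tab_row (one_row m) x"
      if "q permutes {1..m}" "x \<in> {1..m}" for q x
      using that row permutes_in_image[OF that(1)] by metis
    then show ?thesis unfolding row_group_def sum by blast
  qed
  have col: "tab_col (one_row m) x = x" if "x \<in> {1..m}" for x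
    unfolding tab_col_def row[OF that] by simp
  have cols: "col_group (one_row m) = {id}"
  proof -
    have "q = id" if "q permutes {1..m}" "\<forall>x\<in>{1..m}. q x = x" for q
      using that by (metis permutes_def eq_id_iff)
    moreover have "q x = x" if "q permutes {1..m}" "\<forall>x\<in>{1..m}. tab_col (one_row m) (q x) = x"
      "x \<in> {1..m}" for q x
      using that by (metis col permutes_in_image)
    ultimately show ?thesis
      unfolding col_group_def sum using col permutes_id by (auto 4 3)
  qed
  define Y where "Y = (young_symmetrizer (one_row m) :: (nat \<Rightarrow> nat) \<Rightarrow>\<^sub>0 'f)"
  have "finite {q. q permutes {1..m}}" by (simp add: finite_permutations)
  then have Y: "Poly_Mapping.lookup Y q = (if q permutes {1..m} then 1 else 0)" for q
    unfolding Y_def young_symmetrizer_def rows cols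
    by (simp add: lookup_sum lookup_single when_def)
  have push: "Poly_Mapping.lookup (left_mult q f) v = Poly_Mapping.lookup f (Hilbert_Choice.inv q \<circ> v)"
    if "q permutes {1..m}" for q v and f :: "(nat \<Rightarrow> nat) \<Rightarrow>\<^sub>0 'f"
  proof -
    have "q \<circ> w = v \<longleftrightarrow> w = Hilbert_Choice.inv q \<circ> v" for w
      using that by (metis comp_id id_comp permutes_inv_o fun.map_comp)
    then show ?thesis
      unfolding left_mult_def pm_push_def
      by (simp add: lookup_sum lookup_single when_def in_keys_iff)
  qed
  have fixed: "left_mult q (pm_scale c Y) = pm_scale c Y" if q: "q permutes {1..m}" for q c
  proof (rule poly_mapping_eqI)
    fix v
    have "Hilbert_Choice.inv q \<circ> v permutes {1..m} \<longleftrightarrow> v permutes {1..m}"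
    proof
      assume "Hilbert_Choice.inv q \<circ> v permutes {1..m}"
      then have "q \<circ> (Hilbert_Choice.inv q \<circ> v) permutes {1..m}" using q by (rule permutes_compose)
      then show "v permutes {1..m}" using q by (metis fun.map_comp id_comp permutes_inv_o(1))
    next
      assume "v permutes {1..m}"
      then show "Hilbert_Choice.inv q \<circ> v permutes {1..m}" using q by (intro permutes_compose permutes_inv)
    qed
    then show "Poly_Mapping.lookup (left_mult q (pm_scale c Y)) v =
        Poly_Mapping.lookup (pm_scale c Y) v"
      by (simp add: push[OF q] Y)
  qed
  have fixed1: "left_mult q Y = Y" if "q permutes {1..m}" for q
    using fixed[OF that, of 1] by simp
  have specht: "specht_module (one_row m) = pm.span {Y}"
  proof -
    have "{left_mult q Y | q. q permutes {1..m}} = {Y}"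
    proof (intro equalityI subsetI)
      fix y assume "y \<in> {left_mult q Y | q. q permutes {1..m}}"
      then show "y \<in> {Y}" using fixed1 by blast
    next
      fix y assume "y \<in> {Y}"
      then have "y = left_mult id Y" using fixed1[OF permutes_id] by simp
      then show "y \<in> {left_mult q Y | q. q permutes {1..m}}" using permutes_id by blast
    qed
    then show ?thesis unfolding specht_module_def Y_def[symmetric] sum by simp
  qed
  have mem: "v \<in> pm.span {Y} \<longleftrightarrow> (\<exists>c. v = pm_scale c Y)" for v
    by (auto simp: pm.span_singleton)
  have "quot_trace pm_scale (pm.span {Y}) {0} (left_mult p) = of_nat (card {()})"
  proof (rule quot_trace_trivial_action[where l = "\<lambda>_ f. Poly_Mapping.lookup f id" and u = "\<lambda>_. Y"])
    show "{0} = {v \<in> pm.span {Y}. \<forall>x\<in>{()}. Poly_Mapping.lookup v id = 0}"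
      by (auto simp: mem Y permutes_id pm.span_zero)
    show "module.subspace pm_scale (pm.span {Y})" by (rule pm.subspace_span)
    show "Y \<in> pm.span {Y}" by (simp add: pm.span_base)
  qed (auto simp: pm.vector_space_axioms linear_lookup Y permutes_id fixed[OF p] mem)
  then show ?thesis by (simp add: irr_char_def specht)
qed

section \<open>Coordinates of matrices\<close>

text \<open>
  The elements of \<open>\<M>\<close> are indexed by the \<open>k\<^sup>2\<close> pairs below \<open>k\<close>: an off-diagonal pair stands for its
  matrix unit, a diagonal pair \<open>(i, i)\<close> for \<open>h\<^sub>i\<close>, and the last diagonal pair for the identity.
\<close>

definition pairs :: "nat \<Rightarrow> (nat \<times> nat) set" where
  "pairs k = {..<k} \<times> {..<k}"

definition basis_elt :: "nat \<Rightarrow> nat \<times> nat \<Rightarrow> 'f::field mat" where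
  "basis_elt k = (\<lambda>(i, j). if i \<noteq> j then e_mat k i j else if Suc i < k then h_mat k i else g_mat k)"

text \<open>
  The coordinates with respect to \<open>\<M>\<close>. Subtracting the trace part leaves a diagonal with sum 0; since
  \<open>h\<^sub>i\<close> has entries 1 and -1 in the rows \<open>i\<close> and \<open>i + 1\<close>, its coefficient is the partial sum of this
  diagonal up to \<open>i\<close>. The argument is the function of entries, so that linearity can be stated for
  entrywise sums.
\<close>

definition coord :: "nat \<Rightarrow> nat \<times> nat \<Rightarrow> (nat \<times> nat \<Rightarrow> 'f::field) \<Rightarrow> 'f" where
  "coord k = (\<lambda>(i, j) x.
     if i \<noteq> j then x (i, j)
     else if Suc i < k then (\<Sum>q\<le>i. x (q, q)) - of_nat (Suc i) / of_nat k * (\<Sum>q<k. x (q, q))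
     else (\<Sum>q<k. x (q, q)) / of_nat k)"

lemma finite_pairs [simp]: "finite (pairs k)"
  by (simp add: pairs_def)

lemma basis_elt_carrier [simp]: "basis_elt k p \<in> carrier_mat k k"
  by (auto simp: basis_elt_def e_mat_def h_mat_def g_mat_def split: prod.splits)

lemma basis_S_eq: "basis_S k = basis_elt k ` (pairs k - {(k - 1, k - 1)})"
proof -
  have "basis_elt k (i, j) \<in> basis_S k" if "i < k" "j < k" "(i, j) \<noteq> (k - 1, k - 1)" for i j
    using that unfolding basis_S_def basis_elt_def by (cases "i = j") auto
  moreover have "e_mat k i j \<in> basis_elt k ` (pairs k - {(k - 1, k - 1)})"
    if "i < k" "j < k" "i \<noteq> j" for i j
    using that by (intro image_eqI[of _ _ "(i, j)"]) (auto simp: basis_elt_def pairs_def)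
  moreover have "h_mat k i \<in> basis_elt k ` (pairs k - {(k - 1, k - 1)})" if "Suc i < k" for i
    using that by (intro image_eqI[of _ _ "(i, i)"]) (auto simp: basis_elt_def pairs_def)
  ultimately show ?thesis
    unfolding basis_S_def[of k] by (auto simp: pairs_def basis_S_def)
qed

lemma g_mat_eq: "0 < k \<Longrightarrow> g_mat k = basis_elt k (k - 1, k - 1)"
  by (simp add: basis_elt_def)

lemma basis_M_eq: "0 < k \<Longrightarrow> basis_M k = basis_elt k ` pairs k"
proof -
  assume "0 < k"
  then have "pairs k = insert (k - 1, k - 1) (pairs k - {(k - 1, k - 1)})"
    by (auto simp: pairs_def)
  then show ?thesis
    unfolding basis_M_def basis_S_eq g_mat_eq[OF \<open>0 < k\<close>] by (metis Un_insert_right image_insert sup_bot_right)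
qed

lemma basis_S_carrier: "b \<in> basis_S k \<Longrightarrow> b \<in> carrier_mat k k"
  by (auto simp: basis_S_eq)

lemma basis_M_carrier: "0 < k \<Longrightarrow> b \<in> basis_M k \<Longrightarrow> b \<in> carrier_mat k k"
  by (auto simp: basis_M_eq)

lemma coord_cong:
  assumes "p \<in> pairs k" "\<And>i j. i < k \<Longrightarrow> j < k \<Longrightarrow> x (i, j) = y (i, j)"
  shows "coord k p x = coord k p y"
proof -
  have "(\<Sum>q<k. x (q, q)) = (\<Sum>q<k. y (q, q))" using assms(2) by auto
  moreover have "(\<Sum>q\<le>i. x (q, q)) = (\<Sum>q\<le>i. y (q, q))" if "i < k" for i
    using assms(2) that by (intro sum.cong) auto
  ultimately show ?thesis
    using assms by (auto simp: coord_def pairs_def)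
qed

lemma coord_add: "coord k p (\<lambda>ij. x ij + y ij) = coord k p x + coord k p y"
  by (auto simp: coord_def sum.distrib add_divide_distrib algebra_simps split: prod.splits)

lemma coord_scale: "coord k p (\<lambda>ij. c * x ij) = c * coord k p x"
  by (auto simp: coord_def algebra_simps sum_distrib_left[symmetric] split: prod.splits)

lemma coord_zero [simp]: "coord k p (\<lambda>ij. 0) = 0"
  by (auto simp: coord_def split: prod.splits)

lemma coord_sum: "coord k p (\<lambda>ij. \<Sum>w\<in>A. x w ij) = (\<Sum>w\<in>A. coord k p (x w))"
  by (induction A rule: infinite_finite_induct) (simp_all add: coord_add)

lemma coord_basis_elt:
  fixes k :: nat
  assumes k: "0 < k" and p: "p \<in> pairs k" and q: "q \<in> pairs k"
  shows "coord k p (($$) (basis_elt k q)) = (if p = q then 1 else 0 :: 'f::field_char_0)"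
proof -
  obtain i j where p': "p = (i, j)" "i < k" "j < k" using p by (auto simp: pairs_def)
  obtain c d where q': "q = (c, d)" "c < k" "d < k" using q by (auto simp: pairs_def)
  let ?X = "basis_elt k q :: 'f mat"
  consider (off) "c \<noteq> d" | (h) "c = d" "Suc c < k" | (g) "c = d" "Suc c = k"
    using q' by linarith
  then show ?thesis
  proof cases
    case off
    then have X: "?X $$ (a, b) = (if a = c \<and> b = d then 1 else 0)" if "a < k" "b < k" for a b
      using that by (simp add: q' basis_elt_def e_mat_def)
    then have "(\<Sum>r<k. ?X $$ (r, r)) = 0" "(\<Sum>r\<le>i. ?X $$ (r, r)) = 0"
      using off p' by (auto intro!: sum.neutral)
    then show ?thesis using X[OF p'(2,3)] p' q' off by (auto simp: coord_def)
  next
    case h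
    then have X: "?X $$ (a, b) = (if a = b then (if a = c then 1 else 0) - (if a = Suc c then 1 else 0) else 0)"
      if "a < k" "b < k" for a b
      using that by (auto simp: q' basis_elt_def h_mat_def e_mat_def)
    have "(\<Sum>r<k. ?X $$ (r, r)) = (\<Sum>r<k. (if r = c then 1 else 0) - (if r = Suc c then 1 else 0))"
      by (intro sum.cong) (auto simp: X)
    also have "\<dots> = 0" using h by (simp add: sum_subtractf)
    finally have 1: "(\<Sum>r<k. ?X $$ (r, r)) = 0" .
    have "(\<Sum>r\<le>i. ?X $$ (r, r)) = (\<Sum>r\<le>i. (if r = c then 1 else 0) - (if r = Suc c then 1 else 0))"
      using p' by (intro sum.cong) (auto simp: X)
    also have "\<dots> = (if i = c then 1 else 0)" by (auto simp: sum_subtractf)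
    finally show ?thesis using 1 X[OF p'(2,3)] p' q' h by (auto simp: coord_def)
  next
    case g
    then have X: "?X $$ (a, b) = (if a = b then 1 else 0)" if "a < k" "b < k" for a b
      using that by (auto simp: q' basis_elt_def g_mat_def)
    have "(\<Sum>r<k. ?X $$ (r, r)) = of_nat k" by (simp add: X)
    moreover have "(\<Sum>r\<le>i. ?X $$ (r, r)) = of_nat (Suc i)" using p' by (simp add: X)
    ultimately show ?thesis using X[OF p'(2,3)] p' q' g k by (auto simp: coord_def)
  qed
qed

lemma inj_basis_elt:
  assumes "0 < k" shows "inj_on (basis_elt k :: _ \<Rightarrow> 'f::field_char_0 mat) (pairs k)"
  using coord_basis_elt[OF assms, where 'f = 'f] by (intro inj_onI) (metis zero_neq_one)

lemma card_basis_S: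
  assumes "0 < k" shows "card (basis_S k :: 'f::field_char_0 mat set) = k\<^sup>2 - 1"
proof -
  have "card (basis_S k :: 'f mat set) = card (pairs k - {(k - 1, k - 1)})"
    unfolding basis_S_eq using inj_basis_elt[OF assms, where 'f = 'f]
    by (intro card_image) (rule inj_on_subset, auto)
  also have "\<dots> = k\<^sup>2 - 1"
    using assms by (simp add: card_Diff_singleton pairs_def power2_eq_square)
  finally show ?thesis .
qed

lemma coords_zero_imp_zero:
  fixes x :: "nat \<times> nat \<Rightarrow> 'f::field_char_0"
  assumes zero: "\<And>p. p \<in> pairs k \<Longrightarrow> coord k p x = 0" and ij: "i < k" "j < k"
  shows "x (i, j) = 0"
proof (cases "i = j")
  case False
  then show ?thesis using zero[of "(i, j)"] ij by (auto simp: coord_def pairs_def)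
next
  case True
  have tr: "(\<Sum>q<k. x (q, q)) = 0"
    using zero[of "(k - 1, k - 1)"] ij by (auto simp: coord_def pairs_def)
  have part: "(\<Sum>q\<le>c. x (q, q)) = 0" if "c < k" for c
  proof (cases "Suc c < k")
    case True
    then show ?thesis using zero[of "(c, c)"] tr by (auto simp: coord_def pairs_def)
  next
    case False
    then have "k = Suc c" using that by simp
    then show ?thesis using tr by (simp add: lessThan_Suc_atMost)
  qed
  show ?thesis
  proof (cases i)
    case 0
    then show ?thesis using part[of 0] ij True by simp
  next
    case (Suc c)
    then show ?thesis using part[of c] part[of "Suc c"] ij True by simp
  qed
qed

text \<open>
  The difference of the two sides has all coordinates 0 by duality, hence vanishes.
\<close>

lemma entry_expansion:
  fixes x :: "nat \<times> nat \<Rightarrow> 'f::field_char_0"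
  assumes k: "0 < k" and ij: "i < k" "j < k"
  shows "x (i, j) = (\<Sum>p\<in>pairs k. coord k p x * basis_elt k p $$ (i, j))"
proof -
  let ?y = "\<lambda>ij. x ij + (-1) * (\<Sum>p\<in>pairs k. coord k p x * basis_elt k p $$ ij)"
  have "coord k q ?y = 0" if "q \<in> pairs k" for q
  proof -
    have "coord k q ?y = coord k q x - (\<Sum>p\<in>pairs k. coord k p x * coord k q (($$) (basis_elt k p)))"
      unfolding coord_add coord_scale coord_sum by simp
    also have "\<dots> = 0"
      using that by (simp add: coord_basis_elt[OF k] if_distrib[of "\<lambda>z. _ * z"] cong: if_cong)
    finally show ?thesis .
  qed
  from coords_zero_imp_zero[OF this ij] show ?thesis by simp
qed

section \<open>Subspaces of the matrix algebra\<close>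

definition mat_subspace :: "nat \<Rightarrow> 'f::field mat set \<Rightarrow> bool" where
  "mat_subspace k Y \<longleftrightarrow> Y \<subseteq> carrier_mat k k \<and> 0\<^sub>m k k \<in> Y \<and>
     (\<forall>x\<in>Y. \<forall>y\<in>Y. x + y \<in> Y) \<and> (\<forall>c. \<forall>x\<in>Y. c \<cdot>\<^sub>m x \<in> Y)"

lemma mat_subspace_lincomb:
  assumes Y: "mat_subspace k Y" and "finite A" "\<And>p. p \<in> A \<Longrightarrow> E p \<in> Y"
  shows "mat k k (\<lambda>ij. \<Sum>p\<in>A. c p * E p $$ ij) \<in> Y"
  using assms(2,3)
proof (induction A rule: finite_induct)
  case empty
  have "mat k k (\<lambda>ij. \<Sum>p\<in>{}. c p * E p $$ ij) = 0\<^sub>m k k" by (rule eq_matI) auto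
  then show ?case using Y by (simp add: mat_subspace_def)
next
  case (insert q A)
  have E: "E q \<in> carrier_mat k k" using insert.prems Y by (auto simp: mat_subspace_def)
  have "mat k k (\<lambda>ij. \<Sum>p\<in>insert q A. c p * E p $$ ij) =
      c q \<cdot>\<^sub>m E q + mat k k (\<lambda>ij. \<Sum>p\<in>A. c p * E p $$ ij)"
    using insert.hyps E by (intro eq_matI) auto
  then show ?case using insert Y by (auto simp: mat_subspace_def)
qed

lemma mat_subspace_basis_M:
  fixes Y :: "'f::field_char_0 mat set"
  assumes k: "0 < k" and Y: "mat_subspace k Y" and "basis_M k \<subseteq> Y" and X: "X \<in> carrier_mat k k"
  shows "X \<in> Y"
proof -
  have "X = mat k k (\<lambda>ij. \<Sum>p\<in>pairs k. coord k p (($$) X) * basis_elt k p $$ ij)"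
    using X by (intro eq_matI) (auto intro: entry_expansion[OF k])
  also have "\<dots> \<in> Y" using assms(3) basis_M_eq[OF k] by (intro mat_subspace_lincomb[OF Y]) auto
  finally show ?thesis .
qed

lemma mat_subspace_e_mat:
  assumes Y: "mat_subspace k Y" and e: "\<And>i j. i < k \<Longrightarrow> j < k \<Longrightarrow> e_mat k i j \<in> Y"
    and X: "X \<in> carrier_mat k k"
  shows "X \<in> Y"
proof -
  have "X $$ (i, j) = (\<Sum>p\<in>pairs k. X $$ p * e_mat k (fst p) (snd p) $$ (i, j))"
    if "i < k" "j < k" for i j
  proof -
    have "(\<Sum>p\<in>pairs k. X $$ p * e_mat k (fst p) (snd p) $$ (i, j)) =
        (\<Sum>p\<in>pairs k. if p = (i, j) then X $$ p else 0)"
      using that by (intro sum.cong) (auto simp: e_mat_def)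
    then show ?thesis using that by (simp add: pairs_def)
  qed
  then have "X = mat k k (\<lambda>ij. \<Sum>p\<in>pairs k. X $$ p * e_mat k (fst p) (snd p) $$ ij)"
    using X by (intro eq_matI) auto
  also have "\<dots> \<in> Y" using e by (intro mat_subspace_lincomb[OF Y]) (auto simp: pairs_def)
  finally show ?thesis .
qed

text \<open>
  Multiplying \<open>b\<close> by the coordinate at \<open>a\<close> is a linear map with the values that define \<open>\<phi>\<^sub>a\<^sub>b\<close>.
  It is the only one: two such maps agree on a subspace that contains \<open>\<M>\<close>.
\<close>

lemma phi_basis_elt:
  fixes b :: "'f::field_char_0 mat"
  assumes k: "0 < k" and p: "p \<in> pairs k" and b: "b \<in> carrier_mat k k" and X: "X \<in> carrier_mat k k"
  shows "phi k (basis_elt k p) b X = coord k p (($$) X) \<cdot>\<^sub>m b"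
proof -
  define f0 where "f0 = (\<lambda>X\<in>carrier_mat k k. coord k p (($$) X) \<cdot>\<^sub>m b)"
  have lin: "mat_linear k f0"
    unfolding mat_linear_def
  proof (intro conjI ballI allI)
    show "f0 \<in> carrier_mat k k \<rightarrow>\<^sub>E carrier_mat k k" using b by (auto simp: f0_def)
    fix x y :: "'f mat" assume xy: "x \<in> carrier_mat k k" "y \<in> carrier_mat k k"
    have "coord k p (($$) (x + y)) = coord k p (($$) x) + coord k p (($$) y)"
      unfolding coord_add[symmetric] using xy by (intro coord_cong[OF p]) auto
    then show "f0 (x + y) = f0 x + f0 y"
      using xy b by (simp add: f0_def add_smult_distrib_right_mat)
  next
    fix c and x :: "'f mat" assume x: "x \<in> carrier_mat k k"
    have "coord k p (($$) (c \<cdot>\<^sub>m x)) = c * coord k p (($$) x)"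
      unfolding coord_scale[symmetric] using x by (intro coord_cong[OF p]) auto
    then show "f0 (c \<cdot>\<^sub>m x) = c \<cdot>\<^sub>m f0 x" using x b by (auto simp: f0_def)
  qed
  have val: "f0 d = (if d = basis_elt k p then b else 0\<^sub>m k k)" if d: "d \<in> basis_M k" for d
  proof -
    obtain q where q: "q \<in> pairs k" "d = basis_elt k q" using d unfolding basis_M_eq[OF k] by blast
    have "(0::'f) \<cdot>\<^sub>m b = 0\<^sub>m k k" "(1::'f) \<cdot>\<^sub>m b = b" using b by (auto intro!: eq_matI)
    then show ?thesis
      using q p inj_on_eq_iff[OF inj_basis_elt[OF k, where 'f = 'f] q(1) p]
      by (auto simp: f0_def coord_basis_elt[OF k])
  qed
  have "phi k (basis_elt k p) b = f0"
    unfolding phi_def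
  proof (rule the_equality)
    show "mat_linear k f0 \<and> (\<forall>d\<in>basis_M k. f0 d = (if d = basis_elt k p then b else 0\<^sub>m k k))"
      using lin val by simp
    fix f assume f: "mat_linear k f \<and> (\<forall>d\<in>basis_M k. f d = (if d = basis_elt k p then b else 0\<^sub>m k k))"
    let ?Y = "{x \<in> carrier_mat k k. f x = f0 x}"
    have zero: "h (0\<^sub>m k k) = 0\<^sub>m k k" if h: "mat_linear k h" for h :: "'f mat \<Rightarrow> 'f mat"
    proof -
      have "h (0\<^sub>m k k) = h ((0::'f) \<cdot>\<^sub>m 0\<^sub>m k k)" by (rule arg_cong[where f = h]) auto
      also have "\<dots> = 0 \<cdot>\<^sub>m h (0\<^sub>m k k)" using h unfolding mat_linear_def by (metis zero_carrier_mat)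
      also have "\<dots> = 0\<^sub>m k k"
      proof -
        have "h (0\<^sub>m k k) \<in> carrier_mat k k" using h unfolding mat_linear_def by auto
        then show ?thesis by (intro eq_matI) auto
      qed
      finally show ?thesis .
    qed
    have "mat_subspace k ?Y"
      using f lin zero[of f] zero[of f0] unfolding mat_subspace_def mat_linear_def by auto
    moreover have "basis_M k \<subseteq> ?Y" using f val basis_M_carrier[OF k] by auto
    ultimately have "f x = f0 x" if "x \<in> carrier_mat k k" for x
      using mat_subspace_basis_M[OF k] that by blast
    then show "f = f0"
      using f lin unfolding mat_linear_def by (intro ext) (metis PiE_arb)
  qed
  then show ?thesis using X by (simp add: f0_def)
qed

section \<open>Products of elements of \<open>\<S>\<close>\<close>

definition mat_prod :: "nat \<Rightarrow> 'f::field mat list \<Rightarrow> 'f mat" where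
  "mat_prod k bs = foldr (*) bs (1\<^sub>m k)"

lemma mat_prod_carrier: "set bs \<subseteq> carrier_mat k k \<Longrightarrow> mat_prod k bs \<in> carrier_mat k k"
  by (induction bs) (auto simp: mat_prod_def)

text \<open>
  The products of \<open>m\<close> elements of \<open>\<S>\<close> span the scalar matrices if \<open>m = 0\<close>, the traceless matrices
  if \<open>m = 1\<close>, and all matrices if \<open>m \<ge> 2\<close>. In each case the span has a basis contained in \<open>\<M>\<close>, and
  this is its index set.
\<close>

definition span_index :: "nat \<Rightarrow> nat \<Rightarrow> (nat \<times> nat) set" where
  "span_index k m =
     (if m = 0 then {(k - 1, k - 1)} else if m = 1 then pairs k - {(k - 1, k - 1)} else pairs k)"

lemma span_index_subset: "0 < k \<Longrightarrow> span_index k m \<subseteq> pairs k"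
  by (auto simp: span_index_def pairs_def)

lemma card_span_index:
  "0 < k \<Longrightarrow> card (span_index k m) = (if m = 0 then 1 else if m = 1 then k\<^sup>2 - 1 else k\<^sup>2)"
  by (auto simp: span_index_def pairs_def power2_eq_square card_Diff_singleton)

lemma coord_product_outside:
  fixes bs :: "'f::field_char_0 mat list"
  assumes k: "0 < k" and bs: "set bs \<subseteq> basis_S k" "length bs = m" and p: "p \<in> pairs k - span_index k m"
  shows "coord k p (($$) (mat_prod k bs)) = 0"
proof -
  have k1: "(k - 1, k - 1) \<in> pairs k" using k by (auto simp: pairs_def)
  consider "m = 0" | "m = 1" | "m \<ge> 2" by linarith
  then show ?thesis
  proof cases
    case 1
    then have "mat_prod k bs = basis_elt k (k - 1, k - 1)"
      using bs g_mat_eq[OF k, where 'a = 'f] by (simp add: mat_prod_def g_mat_def)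
    then show ?thesis using 1 p coord_basis_elt[OF k _ k1, where 'f = 'f] by (auto simp: span_index_def)
  next
    case 2
    then obtain b where b: "bs = [b]" using bs(2) by (auto simp: length_Suc_conv)
    then obtain q where q: "q \<in> pairs k - {(k - 1, k - 1)}" "b = basis_elt k q"
      using bs(1) by (auto simp: basis_S_eq)
    then have "mat_prod k bs = basis_elt k q"
      using b by (simp add: mat_prod_def right_mult_one_mat[OF basis_elt_carrier])
    then show ?thesis using 2 p q coord_basis_elt[OF k, where 'f = 'f] by (auto simp: span_index_def)
  next
    case 3
    then show ?thesis using p by (auto simp: span_index_def)
  qed
qed

lemma e_mat_carrier: "e_mat k i j \<in> carrier_mat k k"
  by (simp add: e_mat_def)

lemma e_mat_mult:
  assumes "i < k" "j < k" "d < k"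
  shows "e_mat k i j * e_mat k c d = (if j = c then e_mat k i d else (0\<^sub>m k k :: 'f::field mat))"
proof (rule eq_matI)
  fix a b assume "a < dim_row (if j = c then e_mat k i d else (0\<^sub>m k k :: 'f mat))"
    "b < dim_col (if j = c then e_mat k i d else (0\<^sub>m k k :: 'f mat))"
  then have ab: "a < k" "b < k" by (auto simp: e_mat_def split: if_splits)
  have "(e_mat k i j * e_mat k c d :: 'f mat) $$ (a, b) =
      (\<Sum>q<k. e_mat k i j $$ (a, q) * e_mat k c d $$ (q, b))"
    using ab by (simp add: scalar_prod_def atLeast0LessThan e_mat_def)
  also have "\<dots> = (\<Sum>q<k. if q = j then (if a = i \<and> q = c \<and> b = d then 1 else 0) else 0)"
    using ab by (intro sum.cong) (auto simp: e_mat_def)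
  also have "\<dots> = (if a = i \<and> j = c \<and> b = d then 1 else 0)"
    using assms by (subst sum.delta) auto
  finally show "(e_mat k i j * e_mat k c d) $$ (a, b) =
      (if j = c then e_mat k i d else (0\<^sub>m k k :: 'f mat)) $$ (a, b)"
    using ab by (simp add: e_mat_def)
qed (auto simp: e_mat_def)

lemma smult_smult_mat: "a \<cdot>\<^sub>m (b \<cdot>\<^sub>m X) = (a * b) \<cdot>\<^sub>m (X :: 'f::field mat)"
  by (rule eq_matI) auto

text \<open>
  Multiplying \<open>e\<^sub>i\<^sub>j\<close> from the left by an \<open>h\<close> that is nonzero in row \<open>i\<close> only changes its sign, so a
  product that starts with \<open>e\<^sub>i\<^sub>j\<close> can be made as long as required.
\<close>

lemma e_mat_off_diag_product:
  assumes k: "2 \<le> k" and ij: "i < k" "j < k" "i \<noteq> j"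
    and cs: "set cs \<subseteq> basis_S k"
  shows "\<exists>bs s. set bs \<subseteq> basis_S k \<and> length bs = Suc m \<and> s * s = 1 \<and>
    mat_prod k (bs @ cs) = s \<cdot>\<^sub>m (e_mat k i j * mat_prod k cs :: 'f::field mat)"
proof -
  define P where "P = (e_mat k i j * mat_prod k cs :: 'f mat)"
  have P_carr: "mat_prod k cs \<in> carrier_mat k k"
    using cs basis_S_carrier by (intro mat_prod_carrier) blast
  \<comment> \<open>The last row lies only in \<open>h\<close> number \<open>k - 2\<close>, where it carries the entry -1.\<close>
  define H where "H = (if Suc i < k then h_mat k i else h_mat k (i - 1) :: 'f mat)"
  define t where "t = (if Suc i < k then 1 else -1 :: 'f)"
  have HS: "H \<in> basis_S k" using k ij by (auto simp: H_def basis_S_def)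
  have H_carr: "H \<in> carrier_mat k k" using HS basis_S_carrier by blast
  have "H * e_mat k i j = t \<cdot>\<^sub>m e_mat k i j"
  proof (cases "Suc i < k")
    case True
    then show ?thesis using ij
      by (auto simp: H_def t_def h_mat_def minus_mult_distrib_mat[OF e_mat_carrier e_mat_carrier e_mat_carrier] e_mat_mult
          intro!: eq_matI) (auto simp: e_mat_def)
  next
    case False
    then have "Suc (i - 1) = i" "i - 1 < k" "i - 1 \<noteq> i" using k ij by auto
    then show ?thesis using ij False
      by (auto simp: H_def t_def h_mat_def minus_mult_distrib_mat[OF e_mat_carrier e_mat_carrier e_mat_carrier] e_mat_mult
          intro!: eq_matI) (auto simp: e_mat_def)
  qed
  then have HP: "H * P = t \<cdot>\<^sub>m P"
    unfolding P_def assoc_mult_mat[OF H_carr e_mat_carrier P_carr, symmetric]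
    by (simp add: mult_smult_assoc_mat[OF e_mat_carrier P_carr])
  have "mat_prod k (replicate m H @ e_mat k i j # cs) = t ^ m \<cdot>\<^sub>m P"
  proof (induction m)
    case 0
    show ?case by (simp add: mat_prod_def P_def) (rule eq_matI, auto)
  next
    case (Suc m)
    have Pc: "P \<in> carrier_mat k k" unfolding P_def using e_mat_carrier P_carr by (rule mult_carrier_mat)
    have "mat_prod k (replicate (Suc m) H @ e_mat k i j # cs) = H * (t ^ m \<cdot>\<^sub>m P)"
      using Suc by (simp add: mat_prod_def)
    also have "\<dots> = t ^ m \<cdot>\<^sub>m (t \<cdot>\<^sub>m P)" using mult_smult_distrib[OF H_carr Pc] HP by simp
    finally show ?case by (simp add: smult_smult_mat mult.commute)
  qed
  moreover have "t ^ m * t ^ m = 1"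
    by (simp add: t_def power_mult_distrib[symmetric])
  moreover have "e_mat k i j \<in> basis_S k" using ij by (auto simp: basis_S_def)
  ultimately show ?thesis
    using HS unfolding P_def by (intro exI[of _ "replicate m H @ [e_mat k i j]"] exI[of _ "t ^ m"]) auto
qed

text \<open>
  For \<open>m \<ge> 2\<close> every matrix unit is, up to sign, a product of \<open>m\<close> elements of \<open>\<S>\<close>: lengthen \<open>e\<^sub>i\<^sub>j\<close>
  itself if \<open>i \<noteq> j\<close>, and lengthen the factorization \<open>e\<^sub>i\<^sub>i = e\<^sub>i\<^sub>c e\<^sub>c\<^sub>i\<close> otherwise.
\<close>

lemma products_span:
  fixes Y :: "'f::field_char_0 mat set"
  assumes k: "2 \<le> k" and Y: "mat_subspace k Y"
    and prods: "\<And>bs. set bs \<subseteq> basis_S k \<Longrightarrow> length bs = m \<Longrightarrow> mat_prod k bs \<in> Y"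
    and p: "p \<in> span_index k m"
  shows "basis_elt k p \<in> Y"
proof -
  consider "m = 0" | "m = 1" | l where "m = Suc (Suc l)"
    by (metis One_nat_def not0_implies_Suc)
  then show ?thesis
  proof cases
    case 1
    then show ?thesis using prods[of "[]"] p g_mat_eq[of k, where 'a = 'f] k
      by (simp add: span_index_def mat_prod_def g_mat_def)
  next
    case 2
    then have "basis_elt k p \<in> (basis_S k :: 'f mat set)" using p by (auto simp: span_index_def basis_S_eq)
    then show ?thesis using prods[of "[basis_elt k p]"] 2
      by (simp add: mat_prod_def right_mult_one_mat[OF basis_elt_carrier])
  next
    case 3
    have ins: "X \<in> Y" if "s * s = 1" "s \<cdot>\<^sub>m X \<in> Y" for s and X :: "'f mat"
    proof -
      have "s \<cdot>\<^sub>m (s \<cdot>\<^sub>m X) \<in> Y" using that(2) Y by (auto simp: mat_subspace_def)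
      then have "1 \<cdot>\<^sub>m X \<in> Y" using that(1) by (simp add: smult_smult_mat)
      moreover have "1 \<cdot>\<^sub>m X = X" by (rule eq_matI) auto
      ultimately show ?thesis by simp
    qed
    have "e_mat k i j \<in> Y" if ij: "i < k" "j < k" for i j
    proof (cases "i = j")
      case False
      have "e_mat k i j * mat_prod k [] = (e_mat k i j :: 'f mat)" by (simp add: mat_prod_def e_mat_def)
      then show ?thesis
        using e_mat_off_diag_product[where 'f = 'f, OF k ij False, of "[]" "Suc l"] 3 prods ins
        by (metis append_Nil2 empty_subsetI list.set(1))
    next
      case True
      define c where "c = (if i = 0 then 1 else 0 :: nat)"
      have c: "c < k" "i \<noteq> c" using k by (auto simp: c_def)
      have S: "set [e_mat k c i] \<subseteq> (basis_S k :: 'f mat set)" using c ij by (auto simp: basis_S_def)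
      have eq: "e_mat k i c * mat_prod k [e_mat k c i] = (e_mat k i i :: 'f mat)"
        using c ij right_mult_one_mat[of "e_mat k c i :: 'f mat" k k]
        by (simp add: mat_prod_def e_mat_mult e_mat_carrier)
      obtain bs s where "set bs \<subseteq> basis_S k" "length bs = Suc l" "s * s = 1"
        "mat_prod k (bs @ [e_mat k c i]) = s \<cdot>\<^sub>m (e_mat k i i :: 'f mat)"
        using e_mat_off_diag_product[OF k ij(1) c S, of l] unfolding eq by blast
      then show ?thesis
        using prods[of "bs @ [e_mat k c i]"] S 3 ins True by auto
    qed
    then show ?thesis by (rule mat_subspace_e_mat[OF Y]) simp_all
  qed
qed

section \<open>Evaluation of the multilinear monomials\<close>

definition coord_at :: "nat \<Rightarrow> 'f::field mat \<Rightarrow> 'f mat \<Rightarrow> 'f" where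
  "coord_at k a X = coord k (inv_into (pairs k) (basis_elt k) a) (($$) X)"

lemma phi_eq:
  fixes a b :: "'f::field_char_0 mat"
  assumes "0 < k" "a \<in> basis_M k" "b \<in> basis_M k" "X \<in> carrier_mat k k"
  shows "phi k a b X = coord_at k a X \<cdot>\<^sub>m b"
proof -
  have "a \<in> basis_elt k ` pairs k" using assms basis_M_eq by blast
  then have "inv_into (pairs k) (basis_elt k) a \<in> pairs k"
    and "a = basis_elt k (inv_into (pairs k) (basis_elt k) a)"
    by (simp_all add: inv_into_into f_inv_into_f)
  then show ?thesis
    unfolding coord_at_def using phi_basis_elt[OF assms(1)] basis_M_carrier[OF assms(1,3)] assms(4)
    by metis
qed

lemma coord_at_self:
  fixes a :: "'f::field_char_0 mat"
  assumes "0 < k" "a \<in> basis_M k" shows "coord_at k a a = 1"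
proof -
  obtain p where p: "p \<in> pairs k" "a = basis_elt k p" using assms(2) unfolding basis_M_eq[OF assms(1)] by blast
  then have "inv_into (pairs k) (basis_elt k) a = p" by (simp add: inv_into_f_f[OF inj_basis_elt[OF assms(1)]])
  then show ?thesis using p by (simp add: coord_at_def coord_basis_elt[OF assms(1)])
qed

definition word_prod :: "nat \<Rightarrow> 'f::field letter list \<Rightarrow> 'f mat" where
  "word_prod k w = mat_prod k (map (\<lambda>(i, a, b). b) w)"

definition word_coord :: "nat \<Rightarrow> nat \<times> nat \<Rightarrow> 'f::field letter list \<Rightarrow> 'f" where
  "word_coord k p w = coord k p (($$) (word_prod k w))"

lemma eval_word_eq:
  fixes w :: "'f::field_char_0 letter list"
  assumes k: "0 < k" and m: "\<And>i. m i \<in> carrier_mat k k"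
    and w: "\<forall>(i, a, b)\<in>set w. a \<in> basis_M k \<and> b \<in> basis_M k"
  shows "eval_word k m w = prod_list (map (\<lambda>(i, a, b). coord_at k a (m i)) w) \<cdot>\<^sub>m word_prod k w"
  using w
proof (induction w)
  case Nil
  show ?case by (rule eq_matI) (auto simp: eval_word_def word_prod_def mat_prod_def)
next
  case (Cons x w)
  obtain i a b where x: "x = (i, a, b)" by (cases x)
  define c where "c = prod_list (map (\<lambda>(i, a, b). coord_at k a (m i)) w)"
  have ab: "a \<in> basis_M k" "b \<in> basis_M k" using Cons.prems x by auto
  have b: "b \<in> carrier_mat k k" using basis_M_carrier[OF k ab(2)] .
  have "b' \<in> carrier_mat k k" if "(i', a', b') \<in> set w" for i' a' b'
    using Cons.prems that by (intro basis_M_carrier[OF k]) auto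
  then have "set (map (\<lambda>(i, a, b). b) w) \<subseteq> carrier_mat k k" by auto
  then have P: "word_prod k w \<in> carrier_mat k k" unfolding word_prod_def by (rule mat_prod_carrier)
  have "eval_word k m (x # w) = (coord_at k a (m i) \<cdot>\<^sub>m b) * eval_word k m w"
    by (simp add: eval_word_def x phi_eq[OF k ab m])
  also have "eval_word k m w = c \<cdot>\<^sub>m word_prod k w" unfolding c_def using Cons by simp
  also have "(coord_at k a (m i) \<cdot>\<^sub>m b) * (c \<cdot>\<^sub>m word_prod k w) =
      (coord_at k a (m i) * c) \<cdot>\<^sub>m (b * word_prod k w)"
    using b P by (simp add: mult_smult_assoc_mat[OF b smult_carrier_mat[OF P]]
        mult_smult_distrib[OF b P] smult_smult_mat)
  finally show ?case by (simp add: x c_def word_prod_def mat_prod_def)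
qed

lemma indices_D:
  assumes "(I, J, a) \<in> indices k n r"
  shows "I \<inter> J = {}" "I \<union> J = {1..n}" "card I = r" "card J = n - r"
    "\<And>j. j \<in> J \<Longrightarrow> a j \<in> basis_S k"
proof -
  show *: "I \<inter> J = {}" "I \<union> J = {1..n}" "card I = r" "\<And>j. j \<in> J \<Longrightarrow> a j \<in> basis_S k"
    using assms by (auto simp: indices_def)
  have fin: "finite I" "finite J" using *(2) by (metis finite_Un finite_atLeastAtMost)+
  have "card (I \<union> J) = card I + card J" using fin *(1) by (rule card_Un_disjoint)
  then have "n = card I + card J" using *(2) by simp
  then show "card J = n - r" using *(3) by simp
qed

lemma first_exp_basis:
  assumes "(I, J, a) \<in> indices k n r" "i \<in> {1..n}"
  shows "first_exp k (I, J, a) i \<in> basis_M k"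
proof (cases "i \<in> I")
  case False
  then have "a i \<in> basis_S k" using assms(2) indices_D(2,5)[OF assms(1)] by blast
  then show ?thesis using False by (simp add: first_exp_def basis_M_def)
qed (simp add: first_exp_def basis_M_def)

lemma P_words_E:
  assumes "w \<in> P_words k n (I, J, a)"
  obtains \<rho> b where "\<rho> permutes {1..n}" "w = monomial_word k n (I, J, a) \<rho> b"
    "\<And>l. l \<in> {1..n} \<Longrightarrow> \<rho> l \<in> I \<Longrightarrow> b l = g_mat k"
    "\<And>l. l \<in> {1..n} \<Longrightarrow> \<rho> l \<in> J \<Longrightarrow> b l \<in> basis_S k"
  using assms unfolding P_words_def by blast

lemma P_words_letters:
  assumes \<iota>: "(I, J, a) \<in> indices k n r" and n: "1 \<le> n" and w: "w \<in> P_words k n (I, J, a)"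
  shows "w \<noteq> []" "set w \<subseteq> letters k"
proof -
  obtain \<rho> b where w': "\<rho> permutes {1..n}" "w = monomial_word k n (I, J, a) \<rho> b"
    "\<And>l. l \<in> {1..n} \<Longrightarrow> \<rho> l \<in> I \<Longrightarrow> b l = g_mat k"
    "\<And>l. l \<in> {1..n} \<Longrightarrow> \<rho> l \<in> J \<Longrightarrow> b l \<in> basis_S k"
    using P_words_E[OF w] by blast
  show "w \<noteq> []" using n by (simp add: w' monomial_word_def)
  show "set w \<subseteq> letters k"
  proof
    fix x assume "x \<in> set w"
    then have "x \<in> (\<lambda>l. (\<rho> l, first_exp k (I, J, a) (\<rho> l), b l)) ` {1..n}"
      by (auto simp: w'(2) monomial_word_def simp del: upt_Suc)
    then obtain l where l: "l \<in> {1..n}" "x = (\<rho> l, first_exp k (I, J, a) (\<rho> l), b l)"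
      by blast
    have \<rho>: "\<rho> l \<in> {1..n}" using l(1) permutes_in_image[OF w'(1)] by blast
    then have ge: "1 \<le> \<rho> l" by simp
    show "x \<in> letters k"
    proof (cases "\<rho> l \<in> I")
      case True
      then show ?thesis using w'(3)[OF l(1) True] ge by (simp add: l(2) letters_def first_exp_def)
    next
      case False
      then have J: "\<rho> l \<in> J" using \<rho> indices_D(2)[OF \<iota>] by blast
      show ?thesis using w'(4)[OF l(1) J] indices_D(5)[OF \<iota> J] ge False
        by (simp add: l(2) letters_def first_exp_def)
    qed
  qed
qed

lemma letters_basis_M: "(i, a, b) \<in> letters k \<Longrightarrow> a \<in> basis_M k \<and> b \<in> basis_M k"
  by (auto simp: letters_def basis_M_def)

text \<open>
  A letter \<open>x\<^sub>i\<close> with exponent \<open>\<phi>\<^sub>a\<^sub>b\<close> takes the value \<open>b\<close> times the coordinate of \<open>m\<^sub>i\<close> at \<open>a\<close>. As every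
  variable occurs exactly once, and always with the same first index, the scalar in front of
  \<open>b\<^sub>1 \<dots> b\<^sub>n\<close> is the same for all monomials of one component.
\<close>

lemma P_words_eval:
  fixes a :: "nat \<Rightarrow> 'f::field_char_0 mat"
  assumes k: "0 < k" and \<iota>: "(I, J, a) \<in> indices k n r" and n: "1 \<le> n"
    and w: "w \<in> P_words k n (I, J, a)" and m: "\<And>i. m i \<in> carrier_mat k k"
  shows "eval_word k m w =
    (\<Prod>i\<in>{1..n}. coord_at k (first_exp k (I, J, a) i) (m i)) \<cdot>\<^sub>m word_prod k w"
proof -
  obtain \<rho> b where w': "\<rho> permutes {1..n}" "w = monomial_word k n (I, J, a) \<rho> b"
    using P_words_E[OF w] by blast
  let ?c = "\<lambda>i. coord_at k (first_exp k (I, J, a) i) (m i)"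
  have "prod_list (map (\<lambda>(i, a, b). coord_at k a (m i)) w) = prod_list (map (?c \<circ> \<rho>) [1..<Suc n])"
    by (simp add: w'(2) monomial_word_def comp_def del: upt_Suc)
  also have "\<dots> = (\<Prod>l\<in>{1..n}. (?c \<circ> \<rho>) l)"
    by (subst prod.distinct_set_conv_list[symmetric]) (auto intro!: prod.cong)
  also have "\<dots> = (\<Prod>i\<in>{1..n}. ?c i)" using prod.permute[OF w'(1), of ?c] by (simp add: comp_def)
  finally have "prod_list (map (\<lambda>(i, a, b). coord_at k a (m i)) w) = (\<Prod>i\<in>{1..n}. ?c i)" .
  moreover have "\<forall>(i, a, b)\<in>set w. a \<in> basis_M k \<and> b \<in> basis_M k"
  proof clarify
    fix i a' b' assume "(i, a', b') \<in> set w"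
    then have "(i, a', b') \<in> letters k" using P_words_letters(2)[OF \<iota> n w] by blast
    then show "a' \<in> basis_M k \<and> b' \<in> basis_M k" by (rule letters_basis_M)
  qed
  ultimately show ?thesis using eval_word_eq[where w = w, OF k m] by simp
qed

lemma mat_prod_filter:
  assumes "\<And>l. l \<in> set ls \<Longrightarrow> b l \<in> carrier_mat k k" "\<And>l. l \<in> set ls \<Longrightarrow> \<not> P l \<Longrightarrow> b l = 1\<^sub>m k"
  shows "mat_prod k (map b ls) = mat_prod k (map b (filter P ls))"
  using assms
proof (induction ls)
  case (Cons l ls)
  have "mat_prod k (map b (filter P ls)) \<in> carrier_mat k k"
    using Cons.prems by (intro mat_prod_carrier) auto
  then show ?case using Cons by (auto simp: mat_prod_def)
qed simp

lemma word_prod_monomial_word: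
  assumes k: "0 < k"
    and \<rho>: "\<rho> permutes {1..n}" and IJ: "I \<union> J = {1..n}"
    and bI: "\<And>l. l \<in> {1..n} \<Longrightarrow> \<rho> l \<in> I \<Longrightarrow> b l = g_mat k"
    and bJ: "\<And>l. l \<in> {1..n} \<Longrightarrow> \<rho> l \<in> J \<Longrightarrow> b l \<in> basis_S k"
  shows "word_prod k (monomial_word k n (I, J, a) \<rho> b) =
    mat_prod k (map b (filter (\<lambda>l. \<rho> l \<in> J) [1..<Suc n]))"
proof -
  have mem: "\<rho> l \<in> I \<or> \<rho> l \<in> J" if "l \<in> {1..n}" for l
    using that IJ permutes_in_image[OF \<rho>] by blast
  have "word_prod k (monomial_word k n (I, J, a) \<rho> b) = mat_prod k (map b [1..<Suc n])"
    by (simp add: word_prod_def monomial_word_def comp_def del: upt_Suc)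
  also have "\<dots> = mat_prod k (map b (filter (\<lambda>l. \<rho> l \<in> J) [1..<Suc n]))"
  proof (rule mat_prod_filter)
    fix l assume "l \<in> set [1..<Suc n]"
    then have l: "l \<in> {1..n}" by auto
    show "b l \<in> carrier_mat k k"
      using mem[OF l] bI[OF l] bJ[OF l] basis_S_carrier by (auto simp: g_mat_def)
    show "b l = 1\<^sub>m k" if "\<not> \<rho> l \<in> J" using mem[OF l] bI[OF l] that by (simp add: g_mat_def)
  qed
  finally show ?thesis .
qed

text \<open>
  The positions of the variables in \<open>I\<close> contribute identity matrices and can be dropped from the
  product; what remains is one element of \<open>\<S>\<close> for each element of \<open>J\<close>.
\<close>

lemma word_prod_as_product:
  assumes k: "0 < k" and \<iota>: "(I, J, a) \<in> indices k n r" and w: "w \<in> P_words k n (I, J, a)"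
  shows "\<exists>bs. set bs \<subseteq> basis_S k \<and> length bs = n - r \<and> word_prod k w = mat_prod k bs"
proof -
  obtain \<rho> b where w': "\<rho> permutes {1..n}" "w = monomial_word k n (I, J, a) \<rho> b"
    "\<And>l. l \<in> {1..n} \<Longrightarrow> \<rho> l \<in> I \<Longrightarrow> b l = g_mat k"
    "\<And>l. l \<in> {1..n} \<Longrightarrow> \<rho> l \<in> J \<Longrightarrow> b l \<in> basis_S k"
    using P_words_E[OF w] by blast
  let ?ls = "filter (\<lambda>l. \<rho> l \<in> J) [1..<Suc n]"
  have "length ?ls = card (set ?ls)" by (intro distinct_card[symmetric]) (simp del: upt_Suc)
  also have "\<dots> = card (\<rho> ` set ?ls)" by (simp add: card_image permutes_inj_on[OF w'(1)] del: upt_Suc)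
  also have "\<rho> ` set ?ls = J"
  proof -
    have "set ?ls = {l \<in> {1..n}. \<rho> l \<in> J}" by (auto simp del: upt_Suc)
    moreover have "J \<subseteq> \<rho> ` {1..n}" using indices_D(2)[OF \<iota>] permutes_image[OF w'(1)] by blast
    ultimately show ?thesis by blast
  qed
  finally have "length (map b ?ls) = n - r" using indices_D(4)[OF \<iota>] by (simp del: upt_Suc)
  moreover have "b l \<in> basis_S k" if "l \<in> set ?ls" for l
    using that by (intro w'(4)) (auto simp del: upt_Suc)
  then have "set (map b ?ls) \<subseteq> basis_S k" by (simp add: image_subset_iff del: upt_Suc)
  moreover have "word_prod k w = mat_prod k (map b ?ls)"
    unfolding w'(2) by (rule word_prod_monomial_word[OF k w'(1) indices_D(2)[OF \<iota>] w'(3,4)])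
  ultimately show ?thesis by blast
qed

text \<open>
  Used to order the variables so that those in \<open>J\<close> come first; the second exponents of such a
  monomial are then an arbitrary list over \<open>\<S>\<close> followed by identity matrices.
\<close>

lemma permutation_front:
  assumes "I \<inter> J = {}" "I \<union> J = {1..n}" "card J = m"
  shows "\<exists>\<rho>. \<rho> permutes {1..n} \<and> (\<forall>l\<in>{1..n}. \<rho> l \<in> J \<longleftrightarrow> l \<le> m)"
proof -
  have fin: "finite I" "finite J" using assms(2) by (metis finite_Un finite_atLeastAtMost)+
  have c: "card I + m = n" using card_Un_disjoint[OF fin assms(1)] unfolding assms(2,3) by simp
  obtain f where f: "bij_betw f {1..m} J" using finite_same_card_bij[of "{1..m}" J] fin assms(3) by auto
  obtain g where g: "bij_betw g {Suc m..n} I" using finite_same_card_bij[of "{Suc m..n}" I] fin c by auto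
  define \<rho> where "\<rho> l = (if l \<in> {1..m} then f l else if l \<in> {Suc m..n} then g l else l)" for l
  have "bij_betw \<rho> {1..m} J" using f by (rule bij_betw_cong[THEN iffD1, rotated]) (simp add: \<rho>_def)
  moreover have "bij_betw \<rho> {Suc m..n} I"
    using g by (rule bij_betw_cong[THEN iffD1, rotated]) (simp add: \<rho>_def)
  ultimately have "bij_betw \<rho> ({1..m} \<union> {Suc m..n}) (J \<union> I)"
    by (rule bij_betw_combine) (use assms(1) in blast)
  moreover have "{1..m} \<union> {Suc m..n} = {1..n}" using c by auto
  moreover have "J \<union> I = {1..n}" using assms(2) by blast
  ultimately have "bij_betw \<rho> {1..n} {1..n}" by simp
  then have "\<rho> permutes {1..n}"
    using c by (intro bij_imp_permutes) (auto simp: \<rho>_def)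
  moreover have "\<rho> l \<in> J \<longleftrightarrow> l \<le> m" if "l \<in> {1..n}" for l
  proof (cases "l \<le> m")
    case True
    then have l: "l \<in> {1..m}" using that by simp
    then have "\<rho> l = f l" by (simp add: \<rho>_def)
    then show ?thesis using l bij_betwE[OF f] True by simp
  next
    case False
    then have l: "l \<in> {Suc m..n}" using that by simp
    then have "\<rho> l = g l" by (simp add: \<rho>_def)
    then have "\<rho> l \<in> I" using l bij_betwE[OF g] by simp
    then show ?thesis using assms(1) False by blast
  qed
  ultimately show ?thesis by blast
qed

lemma product_as_word_prod:
  assumes k: "0 < k" and \<iota>: "(I, J, a) \<in> indices k n r"
    and bs: "set bs \<subseteq> basis_S k" "length bs = n - r"
  shows "\<exists>w\<in>P_words k n (I, J, a). word_prod k w = mat_prod k bs"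
proof -
  obtain \<rho> where \<rho>: "\<rho> permutes {1..n}" "\<And>l. l \<in> {1..n} \<Longrightarrow> \<rho> l \<in> J \<longleftrightarrow> l \<le> n - r"
    using permutation_front[OF indices_D(1,2,4)[OF \<iota>]] by blast
  define b where "b l = (if l \<le> n - r then bs ! (l - 1) else g_mat k)" for l
  have bJ: "b l \<in> basis_S k" if "l \<in> {1..n}" "\<rho> l \<in> J" for l
  proof -
    have "l - 1 < length bs" using \<rho>(2)[OF that(1)] that bs(2) by auto
    then show ?thesis using \<rho>(2)[OF that(1)] that bs(1) nth_mem by (fastforce simp: b_def)
  qed
  have bI: "b l = g_mat k" if "l \<in> {1..n}" "\<rho> l \<in> I" for l
    using \<rho>(2)[OF that(1)] that indices_D(1)[OF \<iota>] by (auto simp: b_def)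
  have "[1..<Suc n] = [1..<Suc (n - r)] @ [Suc (n - r)..<Suc n]"
    using upt_add_eq_append[of 1 "Suc (n - r)" "n - (n - r)"] by simp
  then have "filter (\<lambda>l. l \<le> n - r) [1..<Suc n] = [1..<Suc (n - r)]"
    by (auto simp: filter_empty_conv filter_id_conv simp del: upt_Suc)
  moreover have "filter (\<lambda>l. \<rho> l \<in> J) [1..<Suc n] = filter (\<lambda>l. l \<le> n - r) [1..<Suc n]"
    using \<rho>(2) by (intro filter_cong) auto
  moreover have "map b [1..<Suc (n - r)] = bs"
    using bs(2) by (auto simp: b_def intro!: nth_equalityI simp del: upt_Suc)
  ultimately have "map b (filter (\<lambda>l. \<rho> l \<in> J) [1..<Suc n]) = bs" by simp
  then have "word_prod k (monomial_word k n (I, J, a) \<rho> b) = mat_prod k bs"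
    using word_prod_monomial_word[OF k \<rho>(1) indices_D(2)[OF \<iota>] bI bJ] by simp
  moreover have "monomial_word k n (I, J, a) \<rho> b \<in> P_words k n (I, J, a)"
    unfolding P_words_def using \<rho>(1) bI bJ by blast
  ultimately show ?thesis by blast
qed

section \<open>Identities among the multilinear elements\<close>

lemma P_space_iff: "f \<in> P_space k n \<iota> \<longleftrightarrow> Poly_Mapping.keys f \<subseteq> P_words k n \<iota>"
proof
  assume "f \<in> P_space k n \<iota>"
  then show "Poly_Mapping.keys f \<subseteq> P_words k n \<iota>"
    unfolding P_space_def
  proof (induction rule: pm.span_induct_alt)
    case (step c x y)
    then obtain w where "x = Poly_Mapping.single w 1" "w \<in> P_words k n \<iota>" by blast
    then have "Poly_Mapping.keys (pm_scale c x) \<subseteq> P_words k n \<iota>"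
      by (auto simp: in_keys_iff lookup_single when_def split: if_splits)
    then show ?case using step Poly_Mapping.keys_add[of "pm_scale c x" y] by blast
  qed simp
next
  assume *: "Poly_Mapping.keys f \<subseteq> P_words k n \<iota>"
  have "f = (\<Sum>w\<in>Poly_Mapping.keys f. pm_scale (Poly_Mapping.lookup f w) (Poly_Mapping.single w 1))"
    by (rule poly_mapping_eqI)
      (simp add: lookup_sum lookup_single when_def in_keys_iff if_distrib[of "\<lambda>z. _ * z"] cong: if_cong)
  also have "\<dots> \<in> P_space k n \<iota>"
    unfolding P_space_def using * by (intro pm.span_sum pm.span_scale pm.span_base) blast
  finally show "f \<in> P_space k n \<iota>" .
qed

lemma coord_pm_eval:
  "coord k p (\<lambda>ij. pm_eval (\<lambda>w. word_prod k w $$ ij) f) = pm_eval (word_coord k p) f"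
  unfolding pm_eval_def coord_sum coord_scale word_coord_def ..

text \<open>
  The common scalar of the monomials equals 1 when each \<open>x\<^sub>i\<close> is evaluated at its own first exponent
  \<open>a\<^sub>i\<close>. So \<open>f\<close> is an identity if and only if the corresponding combination of the products
  \<open>b\<^sub>1 \<dots> b\<^sub>n\<close> is 0. Only coordinates in the span of these products have to be tested.
\<close>

lemma identity_iff_coords:
  fixes a :: "nat \<Rightarrow> 'f::field_char_0 mat"
  assumes k: "0 < k" and \<iota>: "(I, J, a) \<in> indices k n r" and n: "1 \<le> n"
    and f: "f \<in> P_space k n (I, J, a)"
  shows "f \<in> U_identities k \<longleftrightarrow> (\<forall>p\<in>span_index k (n - r). pm_eval (word_coord k p) f = 0)"
proof -
  have keys: "Poly_Mapping.keys f \<subseteq> P_words k n (I, J, a)" using f by (simp add: P_space_iff)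
  then have free: "f \<in> free_alg k" using P_words_letters[OF \<iota> n] unfolding free_alg_def by blast
  have entry: "eval_free k m f $$ (i, j) =
      (\<Prod>i\<in>{1..n}. coord_at k (first_exp k (I, J, a) i) (m i)) * pm_eval (\<lambda>w. word_prod k w $$ (i, j)) f"
    if m: "\<And>i. m i \<in> carrier_mat k k" and ij: "i < k" "j < k" for m i j
  proof -
    have "eval_word k m w $$ (i, j) = (\<Prod>i\<in>{1..n}. coord_at k (first_exp k (I, J, a) i) (m i)) * word_prod k w $$ (i, j)"
      if "w \<in> Poly_Mapping.keys f" for w
    proof -
      have w: "w \<in> P_words k n (I, J, a)" using that keys by blast
      obtain bs where bs: "set bs \<subseteq> basis_S k" "word_prod k w = mat_prod k bs"
        using word_prod_as_product[OF k \<iota> w] by blast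
      then have "word_prod k w \<in> carrier_mat k k" using basis_S_carrier mat_prod_carrier by (metis subset_iff)
      then show ?thesis using P_words_eval[OF k \<iota> n w m] ij by simp
    qed
    then have "eval_free k m f $$ (i, j) = (\<Sum>w\<in>Poly_Mapping.keys f. Poly_Mapping.lookup f w *
        ((\<Prod>i\<in>{1..n}. coord_at k (first_exp k (I, J, a) i) (m i)) * word_prod k w $$ (i, j)))"
      using ij unfolding eval_free_def by simp
    then show ?thesis unfolding pm_eval_def sum_distrib_left by (simp only: mult.left_commute)
  qed
  show ?thesis
  proof
    assume id: "f \<in> U_identities k"
    define m where "m i = (if i \<in> {1..n} then first_exp k (I, J, a) i else 1\<^sub>m k)" for i
    have mc: "m i \<in> carrier_mat k k" for i
      using basis_M_carrier[OF k first_exp_basis[OF \<iota>, of i]] by (simp add: m_def)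
    have "coord_at k (first_exp k (I, J, a) i) (m i) = 1" if "i \<in> {1..n}" for i
      using that coord_at_self[OF k first_exp_basis[OF \<iota> that]] by (simp add: m_def)
    moreover have "eval_free k m f = 0\<^sub>m k k" using id mc by (simp add: U_identities_def)
    ultimately have z: "pm_eval (\<lambda>w. word_prod k w $$ (i, j)) f = 0" if "i < k" "j < k" for i j
      using entry[of m, OF mc that] that by simp
    show "\<forall>p\<in>span_index k (n - r). pm_eval (word_coord k p) f = 0"
    proof
      fix p assume "p \<in> span_index k (n - r)"
      then have "p \<in> pairs k" using span_index_subset[OF k] by blast
      then have "coord k p (\<lambda>ij. pm_eval (\<lambda>w. word_prod k w $$ ij) f) = coord k p (\<lambda>ij. 0)"
        by (rule coord_cong) (rule z)
      then show "pm_eval (word_coord k p) f = 0" by (simp add: coord_pm_eval)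
    qed
  next
    assume z: "\<forall>p\<in>span_index k (n - r). pm_eval (word_coord k p) f = 0"
    have out: "pm_eval (word_coord k p) f = 0" if p: "p \<in> pairs k - span_index k (n - r)" for p
    proof -
      have "word_coord k p w = 0" if "w \<in> Poly_Mapping.keys f" for w
      proof -
        have "w \<in> P_words k n (I, J, a)" using that keys by blast
        then show ?thesis
          unfolding word_coord_def using word_prod_as_product[OF k \<iota>] coord_product_outside[OF k _ _ p] by metis
      qed
      then show ?thesis by (simp add: pm_eval_def)
    qed
    have "coord k p (\<lambda>ij. pm_eval (\<lambda>w. word_prod k w $$ ij) f) = 0" if "p \<in> pairs k" for p
      unfolding coord_pm_eval using z out that by blast
    then have "pm_eval (\<lambda>w. word_prod k w $$ (i, j)) f = 0" if "i < k" "j < k" for i j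
      using coords_zero_imp_zero[where x = "\<lambda>ij. pm_eval (\<lambda>w. word_prod k w $$ ij) f"] that by blast
    then have "eval_free k m f = 0\<^sub>m k k" if "\<And>i. m i \<in> carrier_mat k k" for m
      using entry[of m, OF that] by (intro eq_matI) (auto simp: eval_free_def)
    then show "f \<in> U_identities k" using free by (simp add: U_identities_def)
  qed
qed

text \<open>
  The matrices that are combinations of the products \<open>b\<^sub>1 \<dots> b\<^sub>n\<close> form a subspace. It contains all
  products of \<open>n - r\<close> elements of \<open>\<S>\<close>, hence the basis elements of their span.
\<close>

lemma P_space_dual:
  fixes a :: "nat \<Rightarrow> 'f::field_char_0 mat"
  assumes k: "2 \<le> k" and \<iota>: "(I, J, a) \<in> indices k n r" and p: "p \<in> span_index k (n - r)"
  shows "\<exists>f\<in>P_space k n (I, J, a). \<forall>q\<in>span_index k (n - r).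
    pm_eval (word_coord k q) f = (if q = p then 1 else 0)"
proof -
  let ?P = "P_space k n (I, J, a)"
  define rep where "rep f X \<longleftrightarrow>
    (\<forall>i<k. \<forall>j<k. X $$ (i, j) = pm_eval (\<lambda>w. word_prod k w $$ (i, j)) f)" for f and X :: "'f mat"
  define Y where "Y = {X \<in> carrier_mat k k. \<exists>f\<in>?P. rep f X}"
  have Y_I: "X \<in> Y" if "X \<in> carrier_mat k k" "f \<in> ?P" "rep f X" for X f
    using that unfolding Y_def by blast
  have Y_E: "\<exists>f. X \<in> carrier_mat k k \<and> f \<in> ?P \<and> rep f X" if "X \<in> Y" for X
    using that unfolding Y_def by blast
  have k0: "0 < k" using k by simp
  have sub: "mat_subspace k Y"
    unfolding mat_subspace_def
  proof (intro conjI ballI allI)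
    show "Y \<subseteq> carrier_mat k k" by (auto simp: Y_def)
    show "0\<^sub>m k k \<in> Y"
      by (rule Y_I[of _ 0]) (simp_all add: P_space_def pm.span_zero rep_def)
  next
    fix x y assume "x \<in> Y" "y \<in> Y"
    then obtain f g where f: "f \<in> ?P" "rep f x" "x \<in> carrier_mat k k"
      and g: "g \<in> ?P" "rep g y" "y \<in> carrier_mat k k" by (metis Y_E)
    show "x + y \<in> Y"
    proof (rule Y_I)
      show "f + g \<in> ?P" using f(1) g(1) unfolding P_space_def by (rule pm.span_add)
      show "rep (f + g) (x + y)" using f g by (simp add: rep_def pm_eval_add)
    qed (use f g in simp)
  next
    fix c x assume "x \<in> Y"
    then obtain f where f: "f \<in> ?P" "rep f x" "x \<in> carrier_mat k k" by (metis Y_E)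
    show "c \<cdot>\<^sub>m x \<in> Y"
    proof (rule Y_I)
      show "pm_scale c f \<in> ?P" using f(1) unfolding P_space_def by (rule pm.span_scale)
      show "rep (pm_scale c f) (c \<cdot>\<^sub>m x)" using f by (simp add: rep_def pm_eval_scale)
    qed (use f in simp)
  qed
  have prods: "mat_prod k bs \<in> Y" if bs: "set bs \<subseteq> basis_S k" "length bs = n - r" for bs
  proof -
    obtain w where w: "w \<in> P_words k n (I, J, a)" "word_prod k w = mat_prod k bs"
      using product_as_word_prod[OF k0 \<iota> bs] by blast
    show ?thesis
    proof (rule Y_I)
      show "Poly_Mapping.single w 1 \<in> ?P" unfolding P_space_def using w by (blast intro: pm.span_base)
      show "rep (Poly_Mapping.single w 1) (mat_prod k bs)" using w by (simp add: rep_def pm_eval_single)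
      show "mat_prod k bs \<in> carrier_mat k k" using bs(1) basis_S_carrier by (intro mat_prod_carrier) blast
    qed
  qed
  have "basis_elt k p \<in> Y" using products_span[OF k sub prods p] by blast
  then obtain f where f: "f \<in> ?P" "rep f (basis_elt k p)" by (metis Y_E)
  have "pm_eval (word_coord k q) f = (if q = p then 1 else 0)" if "q \<in> span_index k (n - r)" for q
  proof -
    have pq: "p \<in> pairs k" "q \<in> pairs k" using p that span_index_subset[OF k0] by blast+
    have "coord k q (\<lambda>ij. pm_eval (\<lambda>w. word_prod k w $$ ij) f) = coord k q (($$) (basis_elt k p))"
      using f(2) unfolding rep_def by (intro coord_cong[OF pq(2)]) simp
    then show ?thesis using coord_basis_elt[OF k0 pq(2,1), where 'f = 'f] by (simp add: coord_pm_eval)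
  qed
  then show ?thesis using f(1) by blast
qed

section \<open>The action on the multilinear elements\<close>

lemma keys_pm_push: "Poly_Mapping.keys (pm_push h f) \<subseteq> h ` Poly_Mapping.keys f"
proof
  fix v assume v: "v \<in> Poly_Mapping.keys (pm_push h f)"
  have "Poly_Mapping.lookup (pm_push h f) v = 0" if "v \<notin> h ` Poly_Mapping.keys f"
    unfolding pm_push_def lookup_sum lookup_single
    using that by (intro sum.neutral ballI) (auto simp: when_def)
  then show "v \<in> h ` Poly_Mapping.keys f" using v by (auto simp: in_keys_iff)
qed

text \<open>
  The action changes the variables and the first exponents, but the product \<open>b\<^sub>1 \<dots> b\<^sub>n\<close> only sees
  the second ones. This is why the action on the quotient is trivial.
\<close>

lemma word_coord_perm_act:
  "pm_eval (word_coord k p) (perm_act k \<iota> \<pi> f) = pm_eval (word_coord k p) f"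
proof -
  let ?h = "map (\<lambda>(i, a, b). (\<pi> i, first_exp k \<iota> (\<pi> i), b))"
  have "word_prod k (?h w) = word_prod k w" for w
    by (simp add: word_prod_def comp_def case_prod_beta')
  then have "word_coord k p \<circ> ?h = word_coord k p" by (simp add: fun_eq_iff word_coord_def)
  then show ?thesis unfolding perm_act_def pm_eval_push by simp
qed

lemma perm_act_P_space:
  assumes \<iota>: "(I, J, a) \<in> indices k n r"
    and \<pi>: "\<pi> permutes {1..n}" "\<And>i. i \<in> I \<Longrightarrow> \<pi> i \<in> I" "\<And>j. j \<in> J \<Longrightarrow> \<pi> j \<in> J"
    and f: "f \<in> P_space k n (I, J, a)"
  shows "perm_act k (I, J, a) \<pi> f \<in> P_space k n (I, J, a)"
proof -
  let ?h = "map (\<lambda>(i, a', b). (\<pi> i, first_exp k (I, J, a) (\<pi> i), b))"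
  have "?h w \<in> P_words k n (I, J, a)" if w: "w \<in> P_words k n (I, J, a)" for w
  proof -
    obtain \<rho> b where w': "\<rho> permutes {1..n}" "w = monomial_word k n (I, J, a) \<rho> b"
      "\<And>l. l \<in> {1..n} \<Longrightarrow> \<rho> l \<in> I \<Longrightarrow> b l = g_mat k"
      "\<And>l. l \<in> {1..n} \<Longrightarrow> \<rho> l \<in> J \<Longrightarrow> b l \<in> basis_S k"
      using P_words_E[OF w] by blast
    have "?h w = monomial_word k n (I, J, a) (\<pi> \<circ> \<rho>) b"
      by (simp add: w'(2) monomial_word_def comp_def del: upt_Suc)
    moreover have "\<pi> \<circ> \<rho> permutes {1..n}" using w'(1) \<pi>(1) by (rule permutes_compose)
    moreover have "b l = g_mat k" if l: "l \<in> {1..n}" "(\<pi> \<circ> \<rho>) l \<in> I" for l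
    proof -
      have "\<rho> l \<in> {1..n}" using l(1) permutes_in_image[OF w'(1)] by blast
      then have "\<rho> l \<in> I" using l(2) \<pi>(3)[of "\<rho> l"] indices_D(1,2)[OF \<iota>] unfolding comp_def by blast
      then show ?thesis by (rule w'(3)[OF l(1)])
    qed
    moreover have "b l \<in> basis_S k" if l: "l \<in> {1..n}" "(\<pi> \<circ> \<rho>) l \<in> J" for l
    proof -
      have "\<rho> l \<in> {1..n}" using l(1) permutes_in_image[OF w'(1)] by blast
      then have "\<rho> l \<in> J" using l(2) \<pi>(2)[of "\<rho> l"] indices_D(1,2)[OF \<iota>] unfolding comp_def by blast
      then show ?thesis by (rule w'(4)[OF l(1)])
    qed
    ultimately show ?thesis unfolding P_words_def by blast
  qed
  then have "?h ` P_words k n (I, J, a) \<subseteq> P_words k n (I, J, a)" by (rule image_subsetI)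
  then have "?h ` Poly_Mapping.keys f \<subseteq> P_words k n (I, J, a)"
    using image_mono[OF f[unfolded P_space_iff], of ?h] by (rule order_trans[rotated])
  then show ?thesis
    using keys_pm_push[of ?h f] unfolding P_space_iff perm_act_def by (rule order_trans[rotated])
qed

lemma transport_permutes:
  assumes "bij_betw \<theta> A B" "p permutes B"
  shows "transport A \<theta> p permutes A"
proof (rule bij_imp_permutes)
  have "bij_betw (inv_into A \<theta> \<circ> (p \<circ> \<theta>)) A A"
    using bij_betw_trans[OF bij_betw_trans[OF assms(1) permutes_imp_bij[OF assms(2)]]
        bij_betw_inv_into[OF assms(1)]] .
  then show "bij_betw (transport A \<theta> p) A A"
    by (rule bij_betw_cong[THEN iffD1, rotated]) (simp add: transport_def)
qed (simp add: transport_def)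

section \<open>Counting the components\<close>

lemma finite_basis_S [simp]: "finite (basis_S k)"
  by (simp add: basis_S_eq)

lemma card_indices:
  assumes k: "0 < k"
  shows "finite (indices k n r :: 'f::field_char_0 index set)"
    and "card (indices k n r :: 'f::field_char_0 index set) = (n choose r) * (k\<^sup>2 - 1) ^ (n - r)"
proof -
  let ?I = "{I. I \<subseteq> {1..n} \<and> card I = r}"
  let ?S = "SIGMA I:?I. ({1..n} - I) \<rightarrow>\<^sub>E (basis_S k :: 'f mat set)"
  have eq: "indices k n r = (\<lambda>(I, a). (I, {1..n} - I, a)) ` ?S" (is "_ = ?h ` _")
  proof (intro equalityI subsetI)
    fix x :: "'f index" assume x: "x \<in> indices k n r"
    obtain I J a where x': "x = (I, J, a)" by (cases x)
    have "J = {1..n} - I" "I \<in> ?I" using indices_D(1-3)[OF x[unfolded x']] by blast+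
    moreover have "a \<in> J \<rightarrow>\<^sub>E basis_S k" using x by (simp add: x' indices_def)
    ultimately show "x \<in> ?h ` ?S" unfolding x' by (intro image_eqI[of _ _ "(I, a)"]) simp_all
  next
    fix x :: "'f index" assume "x \<in> ?h ` ?S"
    then obtain I a where x: "x = (I, {1..n} - I, a)" "I \<subseteq> {1..n}" "card I = r"
      "a \<in> ({1..n} - I) \<rightarrow>\<^sub>E basis_S k" by auto
    have "I \<inter> ({1..n} - I) = {}" "I \<union> ({1..n} - I) = {1..n}" using x(2) by blast+
    then show "x \<in> indices k n r" unfolding x(1) indices_def using x(3,4) by blast
  qed
  have finI: "finite ?I" by simp
  have finE: "finite (({1..n} - I) \<rightarrow>\<^sub>E (basis_S k :: 'f mat set))" for I by (intro finite_PiE) auto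
  show "finite (indices k n r :: 'f index set)"
    unfolding eq using finI finE by (intro finite_imageI finite_SigmaI)
  have "card (indices k n r :: 'f index set) = card ?S"
    unfolding eq by (rule card_image) (auto intro!: inj_onI)
  also have "\<dots> = (\<Sum>I\<in>?I. card (({1..n} - I) \<rightarrow>\<^sub>E (basis_S k :: 'f mat set)))"
    using finI finE by (intro card_SigmaI ballI)
  also have "\<dots> = (\<Sum>I\<in>?I. (k\<^sup>2 - 1) ^ (n - r))"
  proof (rule sum.cong[OF refl])
    fix I assume I: "I \<in> ?I"
    then have "finite I" by (metis (no_types, lifting) finite_atLeastAtMost finite_subset mem_Collect_eq)
    then have "card ({1..n} - I) = n - r" using I by (simp add: card_Diff_subset)
    then show "card (({1..n} - I) \<rightarrow>\<^sub>E (basis_S k :: 'f mat set)) = (k\<^sup>2 - 1) ^ (n - r)"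
      by (simp add: card_PiE card_basis_S[OF k])
  qed
  also have "\<dots> = (n choose r) * (k\<^sup>2 - 1) ^ (n - r)" by (simp add: n_subsets)
  finally show "card (indices k n r :: 'f index set) = (n choose r) * (k\<^sup>2 - 1) ^ (n - r)" .
qed

section \<open>The cocharacter\<close>

lemma vector_space_fam_scale:
  "vector_space (fam_scale :: 'f::field \<Rightarrow> ('i \<Rightarrow> ('w \<Rightarrow>\<^sub>0 'f)) \<Rightarrow> 'i \<Rightarrow> ('w \<Rightarrow>\<^sub>0 'f))"
  by unfold_locales
    (simp_all add: fam_scale_def fun_eq_iff pm.scale_right_distrib pm.scale_left_distrib)

text \<open>
  The functionals are the coordinates of the products \<open>b\<^sub>1 \<dots> b\<^sub>n\<close> in each component. They cut out
  the identities, have a dual family, and are invariant under the action, so the trace is the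
  number of components times the dimension of the span of the products.
\<close>

lemma U_cocharacter_eq_card:
  assumes k: "2 \<le> k" and n: "1 \<le> n"
    and \<alpha>: "\<And>I. I \<subseteq> {1..n} \<Longrightarrow> card I = r \<Longrightarrow> bij_betw (\<alpha> I) I {1..r}"
    and \<beta>: "\<And>J. J \<subseteq> {1..n} \<Longrightarrow> card J = n - r \<Longrightarrow> bij_betw (\<beta> J) J {1..n - r}"
    and \<sigma>: "\<sigma> permutes {1..r}" and \<tau>: "\<tau> permutes {1..n - r}"
  shows "(U_cocharacter k n r \<alpha> \<beta> (\<sigma>, \<tau>) :: 'f::field_char_0) =
    of_nat ((n choose r) * (k\<^sup>2 - 1) ^ (n - r) * card (span_index k (n - r)))"
proof -
  have k0: "0 < k" using k by simp
  let ?Ix = "indices k n r :: 'f index set"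
  let ?A = "?Ix \<times> span_index k (n - r)"
  define l where "l x v = pm_eval (word_coord k (snd x)) (v (fst x))"
    for x :: "'f index \<times> nat \<times> nat" and v :: "'f index \<Rightarrow> 'f free_elem"
  define Q where "Q x f \<longleftrightarrow> f \<in> P_space k n (fst x) \<and>
      (\<forall>q\<in>span_index k (n - r). pm_eval (word_coord k q) f = (if q = snd x then 1 else 0))"
    for x :: "'f index \<times> nat \<times> nat" and f
  have "\<exists>f. Q x f" if "x \<in> ?A" for x
  proof -
    obtain I J a p where x: "x = ((I, J, a), p)" by (metis surj_pair)
    show ?thesis
      using P_space_dual[OF k, of I J a n r p] that unfolding Q_def x by auto
  qed
  then obtain F where "\<And>x. x \<in> ?A \<Longrightarrow> Q x (F x)" by metis
  then have F: "\<And>x. x \<in> ?A \<Longrightarrow> F x \<in> P_space k n (fst x)"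
    "\<And>x q. x \<in> ?A \<Longrightarrow> q \<in> span_index k (n - r) \<Longrightarrow>
      pm_eval (word_coord k q) (F x) = (if q = snd x then 1 else 0)"
    unfolding Q_def by blast+
  define u where "u x = (\<lambda>\<iota>. if \<iota> = fst x then F x else 0)" for x
  have zero: "0 \<in> P_space k n \<iota>" for \<iota> :: "'f index" by (simp add: P_space_def pm.span_zero)
  have add: "f + f' \<in> P_space k n \<iota>" if "f \<in> P_space k n \<iota>" "f' \<in> P_space k n \<iota>"
    for \<iota> :: "'f index" and f f' using that unfolding P_space_def by (rule pm.span_add)
  have scale: "pm_scale c f \<in> P_space k n \<iota>" if "f \<in> P_space k n \<iota>"
    for \<iota> :: "'f index" and f c using that unfolding P_space_def by (rule pm.span_scale)
  have "U_cocharacter k n r \<alpha> \<beta> (\<sigma>, \<tau>) = (of_nat (card ?A) :: 'f)"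
    unfolding U_cocharacter_def
  proof (rule quot_trace_trivial_action[where l = l and u = u])
    show "vector_space (fam_scale :: 'f \<Rightarrow> ('f index \<Rightarrow> 'f free_elem) \<Rightarrow> _)"
      by (rule vector_space_fam_scale)
    then interpret vector_space "fam_scale :: 'f \<Rightarrow> ('f index \<Rightarrow> 'f free_elem) \<Rightarrow> _" .
    show "subspace (P_sum k n r :: ('f index \<Rightarrow> 'f free_elem) set)"
      unfolding subspace_def P_sum_def
      by (auto simp: zero add scale fam_scale_def)
    show "finite ?A"
      by (intro finite_cartesian_product card_indices(1)[OF k0]
          finite_subset[OF span_index_subset[OF k0] finite_pairs])
    show "Vector_Spaces.linear fam_scale (*) (l x)" for x
      unfolding Vector_Spaces.linear_iff
      by (intro conjI allI vector_space_fam_scale vector_space_field)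
        (simp_all add: l_def fam_scale_def pm_eval_add pm_eval_scale)
    show Id: "Id_sum k n r = {v \<in> P_sum k n r. \<forall>x\<in>?A. l x v = 0}"
    proof (rule Set.set_eqI)
      fix v :: "'f index \<Rightarrow> 'f free_elem"
      have "v \<iota> \<in> U_identities k \<longleftrightarrow> (\<forall>p\<in>span_index k (n - r). l (\<iota>, p) v = 0)"
        if "\<iota> \<in> ?Ix" "v \<iota> \<in> P_space k n \<iota>" for \<iota>
      proof -
        obtain I J a where \<iota>: "\<iota> = (I, J, a)" by (cases \<iota>)
        show ?thesis
          using identity_iff_coords[OF k0 that(1)[unfolded \<iota>] n that(2)[unfolded \<iota>]]
          by (simp add: l_def \<iota>)
      qed
      then show "v \<in> Id_sum k n r \<longleftrightarrow> v \<in> {v \<in> P_sum k n r. \<forall>x\<in>?A. l x v = 0}"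
        unfolding Id_sum_def P_sum_def by blast
    qed
    show "u x \<in> P_sum k n r" if "x \<in> ?A" for x
      using that F(1)[OF that] by (auto simp: P_sum_def u_def zero)
    show "l x (u y) = (if x = y then 1 else 0)" if "x \<in> ?A" "y \<in> ?A" for x y
      using that F(2)[OF that(2), of "snd x"] by (auto simp: l_def u_def prod_eq_iff)
    fix v :: "'f index \<Rightarrow> 'f free_elem" assume v: "v \<in> P_sum k n r"
    let ?T = "sum_act k \<alpha> \<beta> (\<sigma>, \<tau>)"
    have "?T v \<in> P_sum k n r"
      unfolding P_sum_def
    proof (intro CollectI conjI ballI allI impI)
      fix \<iota> :: "'f index" assume \<iota>: "\<iota> \<in> ?Ix"
      obtain I J a where \<iota>': "\<iota> = (I, J, a)" by (cases \<iota>)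
      note D = indices_D(1-4)[OF \<iota>[unfolded \<iota>']]
      let ?p = "transport I (\<alpha> I) \<sigma>" and ?q = "transport J (\<beta> J) \<tau>"
      have p: "?p permutes I" using \<alpha>[of I] D by (intro transport_permutes[OF _ \<sigma>]) blast
      have q: "?q permutes J" using \<beta>[of J] D by (intro transport_permutes[OF _ \<tau>]) blast
      have pq: "?p \<circ> ?q permutes {1..n}"
        unfolding D(2)[symmetric]
        by (intro permutes_compose permutes_subset[OF p] permutes_subset[OF q]) auto
      have "(?p \<circ> ?q) i \<in> I" if "i \<in> I" for i
      proof -
        have "?q i = i" using that D(1) by (intro permutes_not_in[OF q]) blast
        then show ?thesis using that permutes_in_image[OF p, of i] by simp
      qed
      moreover have "(?p \<circ> ?q) j \<in> J" if "j \<in> J" for j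
      proof -
        have j: "?q j \<in> J" using that permutes_in_image[OF q, of j] by blast
        then have "?p (?q j) = ?q j" using D(1) by (intro permutes_not_in[OF p]) blast
        then show ?thesis using j by simp
      qed
      moreover have "v (I, J, a) \<in> P_space k n (I, J, a)" using v \<iota> by (simp add: P_sum_def \<iota>')
      ultimately show "?T v \<iota> \<in> P_space k n \<iota>"
        using perm_act_P_space[OF \<iota>[unfolded \<iota>'] pq] by (simp add: \<iota>' sum_act_def)
    next
      fix \<iota> :: "'f index" assume "\<iota> \<notin> ?Ix"
      then have "v \<iota> = 0" using v unfolding P_sum_def by blast
      then show "?T v \<iota> = 0" by (cases \<iota>) (simp add: sum_act_def perm_act_def pm_push_def)
    qed
    then have "?T v - v \<in> P_sum k n r"
      using v \<open>subspace (P_sum k n r)\<close> by (intro subspace_diff)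
    moreover have "l x (?T v - v) = 0" for x
    proof -
      obtain I J a p where x: "x = ((I, J, a), p)" by (metis surj_pair)
      have "pm_eval g (f - f') = pm_eval g f - pm_eval g f'" for g and f f' :: "'f free_elem"
        using pm_eval_add[of g "f - f'" f'] by simp
      then show ?thesis by (simp add: x l_def sum_act_def word_coord_perm_act)
    qed
    ultimately show "?T v - v \<in> Id_sum k n r" unfolding Id by blast
  qed
  then show ?thesis by (simp add: card_cartesian_product card_indices(2)[OF k0])
qed

theorem theorem6p1p3:
  fixes k n r :: nat
    and \<alpha> \<beta> :: "nat set \<Rightarrow> nat \<Rightarrow> nat"
    and \<sigma> \<tau> :: "nat \<Rightarrow> nat"
  assumes "2 \<le> k" and "1 \<le> n" and "r \<le> n"
    and "\<And>I. I \<subseteq> {1..n} \<Longrightarrow> card I = r \<Longrightarrow> bij_betw (\<alpha> I) I {1..r}"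
    and "\<And>J. J \<subseteq> {1..n} \<Longrightarrow> card J = n - r \<Longrightarrow> bij_betw (\<beta> J) J {1..n - r}"
    and "\<sigma> permutes {1..r}" and "\<tau> permutes {1..n - r}"
  shows "(U_cocharacter k n r \<alpha> \<beta> (\<sigma>, \<tau>) :: 'f::field_char_0) =
    (if r = n then
       of_nat (n choose r) * char_tensor (irr_char [n]) (irr_char []) (\<sigma>, \<tau>)
     else if r = n - 1 then
       of_nat ((n choose r) * (k\<^sup>2 - 1)\<^sup>2) *
         char_tensor (irr_char (one_row (n - 1))) (irr_char [1]) (\<sigma>, \<tau>)
     else
       of_nat ((n choose r) * (k\<^sup>2 - 1) ^ (n - r) * k\<^sup>2) *
         char_tensor (irr_char (one_row r)) (irr_char (one_row (n - r))) (\<sigma>, \<tau>))"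
proof -
  have k: "0 < k" using assms(1) by simp
  have triv: "char_tensor (irr_char (one_row r)) (irr_char (one_row (n - r))) (\<sigma>, \<tau>) = (1 :: 'f)"
    by (simp add: char_tensor_def irr_char_one_row[OF assms(6)] irr_char_one_row[OF assms(7)])
  have U: "U_cocharacter k n r \<alpha> \<beta> (\<sigma>, \<tau>) =
      (of_nat ((n choose r) * (k\<^sup>2 - 1) ^ (n - r) * card (span_index k (n - r))) :: 'f)"
    using assms by (intro U_cocharacter_eq_card)
  consider "r = n" | "r \<noteq> n" "r = n - 1" | "r \<noteq> n" "r \<noteq> n - 1" by blast
  then show ?thesis
  proof cases
    case 1
    then have "one_row r = [n]" "one_row (n - r) = []" using assms(2) by (auto simp: one_row_def)
    then show ?thesis using triv U 1 card_span_index[OF k, of 0] by simp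
  next
    case 2
    then have m: "n - r = 1" using assms(2) by simp
    then have "one_row (n - r) = [1]" by (simp add: one_row_def)
    then show ?thesis
      using triv U 2 card_span_index[OF k, of 1] unfolding m by (simp add: power2_eq_square mult.assoc)
  next
    case 3
    then have "card (span_index k (n - r)) = k\<^sup>2"
      using assms(3) card_span_index[OF k, of "n - r"] by simp
    then show ?thesis using triv U 3 by simp
  qed
qed

end
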